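(* Consider the Gumbel-max watermark model of the context with $\varepsilon_n\asymp n^{-p}$, and suppose Assumptions (A) and (B) hold with constants $0\le p\le \frac12$ and $0\le q\le 1$. (a) If $q+2p>1$, then $H_0$ and $H_1^{\mathrm{mix}}$ merge asymptotically (the total variation distance between the joint laws of $Y_{1:n}$ under the two hypotheses tends to $0$); hence for any test the sum of Type I and Type II errors tends to $1$ as $n\to\infty$. (b) If $q+2p<1$, then $H_0$ and $H_1^{\mathrm{mix}}$ separate asymptotically; moreover, for the likelihood-ratio test that rejects $H_0$ when the log of the ratio of the joint density of $Y_{1:n}$ under $H_1^{\mathrm{mix}}$ to that under $H_0$ is positive, the sum of Type I and Type II errors tends to $0$ as $n\to\infty$.
   Context: Notation: $a_n \asymp b_n$ means there are constants $C_1,C_2>0$ with $C_1 a_n\le b_n\le C_2 a_n$ for all $n$. $\mathcal{W}$ is a finite vocabulary. For a probability vector $\mathbf{P}=(P_w)_{w\in\mathcal{W}}$, $\mu_{1,\mathbf{P}}$ is the distribution on $[0,1]$ with CDF $F_{1,\mathbf{P}}(r)=\sum_w P_w r^{1/P_w}$; $\mu_0=U(0,1)$. Watermark model: for $t=1,\dots,n$ a random next-token distribution $\mathbf{P}_t$ is produced, $\xi_t=(U_{t,w})_{w\in\mathcal{W}}$ has i.i.d. $U(0,1)$ entries, the decoder is $\mathcal{S}(\mathbf{P},\xi)=\arg\max_w \frac{\log U_w}{P_w}$, the observed token is $w_t$ and $Y_t=U_{t,w_t}$. Let $\mathcal{F}_{t-1}=\sigma(\{w_j,\xi_j,\mathbf{P}_{j+1}\}_{j=1}^{t-1})$.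 Assumption (A): (a) $\xi_1,\dots,\xi_n$ are i.i.d. and $\xi_t$ is independent of $\mathcal{F}_{t-1}$; (b) with probability $\varepsilon_n$, $w_t=\mathcal{S}(\mathbf{P}_t,\xi_t)$; otherwise $w_t$ is drawn from $\mathbf{P}_t$ and, conditionally on $\mathcal{F}_{t-1}$, is independent of $\xi_t$. Assumption (B): with $\Delta(\mathbf{P}):=1-\max_{w}P_w$, one has $\Delta(\mathbf{P}_t)=\Delta_n$ for all $1\le t\le n$, where $\Delta_n\asymp n^{-q}$. $H_1^{\mathrm{mix}}$ is the joint law of $Y_{1:n}$ under this model; $H_0$ is the law under which $Y_1,\dots,Y_n$ are i.i.d. $U(0,1)$. Two hypotheses merge asymptotically if the total variation distance between the joint laws tends to $0$, and separate asymptotically otherwise. *)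

theory Defs
  imports "HOL-Probability.Probability"
begin

definition vecM :: "('w \<Rightarrow> real) measure" where
  "vecM = Pi\<^sub>M UNIV (\<lambda>_. borel)"

definition probvec :: "('w::finite \<Rightarrow> real) \<Rightarrow> bool" where
  "probvec P \<longleftrightarrow> (\<forall>w. 0 \<le> P w) \<and> sum P UNIV = 1"

definition gap :: "('w::finite \<Rightarrow> real) \<Rightarrow> real" where
  "gap P = 1 - Max (range P)"

text \<open>Gumbel-max decoder argmax_w log(U_w)/P_w. Tokens with P_w = 0 have log U_w / P_w = -infinity
  and are never selected; ties (a null event) are broken by the least token.\<close>
definition gumbel_dec :: "('w::{finite,linorder} \<Rightarrow> real) \<Rightarrow> ('w \<Rightarrow> real) \<Rightarrow> 'w" where
  "gumbel_dec P \<xi> = (LEAST w. 0 < P w \<and> (\<forall>v. 0 < P v \<longrightarrow> ln (\<xi> v) / P v \<le> ln (\<xi> w) / P w))"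

definition unif01 :: "real measure" where
  "unif01 = uniform_measure lborel {0..1}"

definition xi_law :: "('w \<Rightarrow> real) measure" where
  "xi_law = Pi\<^sub>M UNIV (\<lambda>_. unif01)"

definition cat :: "('w \<Rightarrow> real) \<Rightarrow> 'w measure" where
  "cat P = density (count_space UNIV) (\<lambda>w. ennreal (P w))"

type_synonym 'w state = "('w \<Rightarrow> real) \<times> ('w \<Rightarrow> real) \<times> 'w"  (* (P_t, xi_t, w_t) *)

definition stateM :: "'w state measure" where
  "stateM = vecM \<Otimes>\<^sub>M (vecM \<Otimes>\<^sub>M count_space UNIV)"

definition histM :: "(nat \<Rightarrow> 'w state) measure" where
  "histM = Pi\<^sub>M UNIV (\<lambda>_. stateM)"

definition step_law :: "real \<Rightarrow> ('w::{finite,linorder} \<Rightarrow> real) \<Rightarrow> (('w \<Rightarrow> real) \<times> 'w) measure" where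
  "step_law eps P =
     xi_law \<bind> (\<lambda>\<xi>. measure_pmf (bernoulli_pmf eps) \<bind> (\<lambda>b.
       (if b then return (count_space UNIV) (gumbel_dec P \<xi>) else cat P) \<bind>
         (\<lambda>w. return (vecM \<Otimes>\<^sub>M count_space UNIV) (\<xi>, w))))"

text \<open>Law of the history (P_j, xi_j, w_j)_{j<t}; entries j >= t are a fixed dummy value.
  The kernel K t maps the history F_{t} to the law of the next P (0-based index t).\<close>
primrec hist :: "real \<Rightarrow> (nat \<Rightarrow> (nat \<Rightarrow> 'w state) \<Rightarrow> ('w \<Rightarrow> real) measure) \<Rightarrow> nat
    \<Rightarrow> (nat \<Rightarrow> ('w::{finite,linorder}) state) measure" where
  "hist eps K 0 = return histM (\<lambda>_. undefined)"
| "hist eps K (Suc t) = hist eps K t \<bind> (\<lambda>h. K t h \<bind> (\<lambda>P. step_law eps P \<bind>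
      (\<lambda>xw. return histM (h(t := (P, xw))))))"

definition Yspace :: "nat \<Rightarrow> (nat \<Rightarrow> real) measure" where
  "Yspace n = Pi\<^sub>M {..<n} (\<lambda>_. borel)"

definition H1law :: "real \<Rightarrow> (nat \<Rightarrow> (nat \<Rightarrow> 'w::{finite,linorder} state) \<Rightarrow> ('w \<Rightarrow> real) measure) \<Rightarrow> nat
    \<Rightarrow> (nat \<Rightarrow> real) measure" where
  "H1law eps K n = distr (hist eps K n) (Yspace n)
     (\<lambda>h. \<lambda>t\<in>{..<n}. fst (snd (h t)) (snd (snd (h (t::nat)))))"

definition H0law :: "nat \<Rightarrow> (nat \<Rightarrow> real) measure" where
  "H0law n = Pi\<^sub>M {..<n} (\<lambda>_. unif01)"

definition tvdist :: "'a measure \<Rightarrow> 'a measure \<Rightarrow> real" where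
  "tvdist M N = (SUP A\<in>sets M. \<bar>measure M A - measure N A\<bar>)"

definition asymp_equiv :: "(nat \<Rightarrow> real) \<Rightarrow> (nat \<Rightarrow> real) \<Rightarrow> bool" where
  "asymp_equiv a b \<longleftrightarrow> (\<exists>C1 C2. C1 > 0 \<and> C2 > 0 \<and> (\<forall>n\<ge>1. C1 * a n \<le> b n \<and> b n \<le> C2 * a n))"

definition lebM :: "nat \<Rightarrow> (nat \<Rightarrow> real) measure" where
  "lebM n = Pi\<^sub>M {..<n} (\<lambda>_. lborel)"

definition LR_reject :: "real \<Rightarrow> (nat \<Rightarrow> (nat \<Rightarrow> 'w::{finite,linorder} state) \<Rightarrow> ('w \<Rightarrow> real) measure) \<Rightarrow> nat
    \<Rightarrow> (nat \<Rightarrow> real) set" where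
  "LR_reject eps K n = {y \<in> space (Yspace n).
     ln (enn2real (RN_deriv (lebM n) (H1law eps K n) y) / enn2real (RN_deriv (lebM n) (H0law n) y)) > 0}"

end

theory Submission
  imports Defs
begin

text \<open>Given the past, the density of the next observation is \<open>mix_dens\<close>, that is
  \<open>1 - \<epsilon> + \<epsilon> f\<^bsub>P\<^esub>(u)\<close> with \<open>f\<^bsub>P\<^esub>(u) = \<Sum>\<^bsub>w\<^esub> u powr (1/P\<^bsub>w\<^esub> - 1)\<close>. Only the
  upper bound of conditional expectations by integrals against this density is needed, so ties of
  the decoder never matter.

  Merging: since \<open>\<integral> f\<^bsub>P\<^esub>\<^sup>2 \<le> 1 + |W|\<^sup>2 \<Delta>\<close>, the Cauchy-Schwarz inequality applied one step at a time gives
  \<open>(E\<^bsub>1\<^esub> G)\<^sup>2 \<le> (1 + \<epsilon>\<^sup>2 |W|\<^sup>2 \<Delta>)\<^sup>n E\<^bsub>0\<^esub> G\<^sup>2\<close>, and \<open>n \<epsilon>\<^sup>2 \<Delta> \<rightarrow> 0\<close> in this regime; the choice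
  \<open>G = 1 + s 1\<^bsub>A\<^esub>\<close> with small \<open>s\<close> bounds \<open>H\<^bsub>1\<^esub>(A) - H\<^bsub>0\<^esub>(A)\<close> uniformly in \<open>A\<close>.

  Separation: the likelihood-ratio test minimises the sum of the two error probabilities, so it is
  enough to exhibit one good test. Count the observations above \<open>1 - \<Delta>/2\<close>: the expected number is
  \<open>n \<Delta>/2\<close> under the null hypothesis and at least \<open>n (\<Delta>/2 + \<epsilon> \<Delta>/10)\<close> under the alternative, and
  Chernoff bounds make both errors of the test with a threshold in between at most
  \<open>exp (- n \<Delta> \<epsilon>\<^sup>2 / 1000)\<close>, where now \<open>n \<epsilon>\<^sup>2 \<Delta> \<rightarrow> \<infinity>\<close>.\<close>

section \<open>Measurability of the token kernel\<close>

text \<open>If \<open>P\<close> is not a probability vector, \<^const>\<open>cat\<close> may have total mass above 1, and the kernel that is bound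
  in \<^const>\<open>step_law\<close> is not measurable into a subprobability algebra. As the pmf is
  discrete, \<open>bind\<close> then simply drops the offending branches, which keeps \<open>step_law eps P\<close>
  measurable in \<open>P\<close> over the whole space of vectors.\<close>

lemma emeasure_bind_pmf_partial:
  assumes sets: "\<And>x. sets (f x) = sets N" and ne: "space N \<noteq> {}" and A: "A \<in> sets N"
  shows "emeasure (measure_pmf p \<bind> f) A =
    (\<integral>\<^sup>+x. (if subprob_space (f x) then emeasure (f x) A else 0) \<partial>measure_pmf p)"
proof -
  let ?S = "subprob_algebra N"
  let ?good = "{x. subprob_space (f x)}"
  \<comment> \<open>Values of \<open>f\<close> that are not subprobability measures lie outside the
    space of \<open>?S\<close>, so no set of \<open>?S\<close> has them in its preimage. Restricting
    the pmf to the good points and changing \<open>f\<close> elsewhere to \<open>f'\<close> leaves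
    the push-forward as it was, and \<open>f'\<close> is measurable.\<close>
  define f' where "f' x = (if subprob_space (f x) then f x else null_measure N)" for x
  define p' where "p' = density (measure_pmf p) (indicator ?good)"
  have sp: "subprob_algebra (f x) = ?S" for x
    by (intro subprob_algebra_cong sets)
  have f'[measurable]: "f' \<in> measurable (count_space UNIV) ?S"
    using sets ne subprob_space_null_measure[of N] by (simp add: f'_def space_subprob_algebra)
  have f'p: "f' \<in> measurable p' ?S"
    unfolding p'_def using f' by (simp cong: measurable_cong_sets)
  have "distr (measure_pmf p) ?S f = distr p' ?S f'"
    unfolding distr_def
  proof (rule measure_of_eq)
    show "sets ?S \<subseteq> Pow (space ?S)" by (rule sets.space_closed)
    fix B assume "B \<in> sigma_sets (space ?S) (sets ?S)"
    then have "B \<in> sets ?S" by (simp add: sets.sigma_sets_eq)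
    then have B: "B \<subseteq> space ?S" by (rule sets.sets_into_space)
    have "emeasure p' (f' -` B \<inter> space p') = (\<integral>\<^sup>+x. indicator (?good \<inter> f' -` B) x \<partial>measure_pmf p)"
      by (simp add: p'_def emeasure_density indicator_inter_arith)
    also have "\<dots> = emeasure (measure_pmf p) (?good \<inter> f' -` B)"
      by (rule nn_integral_indicator) simp
    also have "?good \<inter> f' -` B = f -` B"
      using B by (auto simp: f'_def space_subprob_algebra)
    finally show "emeasure (measure_pmf p) (f -` B \<inter> space (measure_pmf p)) =
        emeasure p' (f' -` B \<inter> space p')"
      by simp
  qed
  then have "emeasure (measure_pmf p \<bind> f) A = emeasure (join (distr p' ?S f')) A"
    by (simp add: bind_nonempty sp)
  also have "\<dots> = (\<integral>\<^sup>+x. emeasure (f' x) A \<partial>p')"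
    using A by (subst emeasure_join[where N=N])
      (auto simp: nn_integral_distr[OF f'p] measurable_emeasure_subprob_algebra)
  also have "\<dots> = (\<integral>\<^sup>+x. (if subprob_space (f x) then emeasure (f x) A else 0) \<partial>measure_pmf p)"
    unfolding p'_def
    by (subst nn_integral_density) (auto intro!: nn_integral_cong simp: f'_def split: split_indicator)
  finally show ?thesis .
qed

lemma space_vecM [simp]: "space vecM = UNIV"
  by (simp add: vecM_def space_PiM)

lemma space_histM [simp]: "space histM = UNIV"
  by (simp add: histM_def stateM_def space_PiM space_pair_measure)

lemma measurable_vecM_apply: "(\<lambda>P. P w) \<in> borel_measurable vecM"
  by (simp add: vecM_def)

lemma measurable_vecM_compose [measurable (raw)]:
  "f \<in> measurable M vecM \<Longrightarrow> (\<lambda>x. f x w) \<in> borel_measurable M"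
  by (rule measurable_compose[OF _ measurable_vecM_apply])

lemma prob_space_unif01: "prob_space unif01"
  unfolding unif01_def by (rule prob_space_uniform_measure) auto

lemma sets_unif01 [simp, measurable_cong]: "sets unif01 = sets borel"
  by (simp add: unif01_def)

lemma space_unif01 [simp]: "space unif01 = UNIV"
  by (simp add: unif01_def)

lemma product_sigma_finite_unif01: "product_sigma_finite (\<lambda>_. unif01)"
  unfolding product_sigma_finite_def using prob_space_unif01 prob_space_imp_sigma_finite by blast

lemma prob_space_xi_law: "prob_space xi_law"
  unfolding xi_law_def by (rule prob_space_PiM) (rule prob_space_unif01)

lemma sets_xi_law [simp, measurable_cong]: "sets xi_law = sets vecM"
  unfolding xi_law_def vecM_def by (rule sets_PiM_cong) auto

lemma space_xi_law [simp]: "space xi_law = UNIV"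
  using sets_eq_imp_space_eq[OF sets_xi_law] by simp

lemma space_cat [simp]: "space (cat P) = UNIV"
  by (simp add: cat_def)

lemma sets_cat [simp, measurable_cong]: "sets (cat P) = UNIV"
  by (simp add: cat_def)

lemma nn_integral_cat:
  "(\<integral>\<^sup>+w. g w \<partial>cat P) = (\<Sum>w\<in>UNIV. ennreal (P w) * g w)" for P :: "'w::finite \<Rightarrow> real"
  by (simp add: cat_def nn_integral_density nn_integral_count_space_finite)

text \<open>The part of \<open>step_law\<close> that follows the draw of \<open>\<xi>\<close>, split
  off because its measurability has to be shown jointly in the vector and in
  \<open>\<xi>\<close>.\<close>

definition token_law :: "real \<Rightarrow> ('w::{finite,linorder} \<Rightarrow> real) \<Rightarrow> ('w \<Rightarrow> real) \<Rightarrow> (('w \<Rightarrow> real) \<times> 'w) measure"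
  where "token_law eps P \<xi> = measure_pmf (bernoulli_pmf eps) \<bind> (\<lambda>b.
       (if b then return (count_space UNIV) (gumbel_dec P \<xi>) else cat P) \<bind>
         (\<lambda>w. return (vecM \<Otimes>\<^sub>M count_space UNIV) (\<xi>, w)))"

abbreviation obsM :: "(('w \<Rightarrow> real) \<times> 'w) measure"
  where "obsM \<equiv> vecM \<Otimes>\<^sub>M count_space UNIV"

lemma measurable_return_obsM:
  "(\<lambda>w. return obsM (\<xi>, w)) \<in> measurable (count_space UNIV) (subprob_algebra obsM)"
  by (auto simp: space_subprob_algebra space_pair_measure intro!: subprob_space_return)

lemma measurable_return_obsM_cat:
  "(\<lambda>w. return obsM (\<xi>, w)) \<in> measurable (cat P) (subprob_algebra obsM)"
  by (subst measurable_cong_sets[OF _ refl, where M' = "count_space UNIV"])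
    (simp_all only: measurable_return_obsM sets_cat sets_count_space Pow_UNIV)

lemma emeasure_cat_bind_return:
  fixes P :: "'w::finite \<Rightarrow> real"
  assumes "A \<in> sets obsM"
  shows "emeasure (cat P \<bind> (\<lambda>w. return obsM (\<xi>, w))) A = (\<Sum>w\<in>UNIV. ennreal (P w) * indicator A (\<xi>, w))"
  using assms by (simp add: emeasure_bind[OF _ measurable_return_obsM_cat] nn_integral_cat)

lemma token_branches:
  fixes P :: "'w::{finite,linorder} \<Rightarrow> real"
  shows "((if b then return (count_space UNIV) (gumbel_dec P \<xi>) else cat P) \<bind>
         (\<lambda>w. return obsM (\<xi>, w))) =
     (if b then return obsM (\<xi>, gumbel_dec P \<xi>) else cat P \<bind> (\<lambda>w. return obsM (\<xi>, w)))"
  by (simp add: bind_return[OF measurable_return_obsM])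

lemma sets_cat_bind [simp]:
  "sets (cat P \<bind> (\<lambda>w. return obsM (\<xi>, w))) = sets obsM"
  by (rule sets_bind) simp_all

text \<open>An explicit formula for every real vector \<open>P\<close>, from which measurability in
  \<open>(P, \<xi>)\<close> can be read off. Negative entries are cut to 0 by
  \<open>ennreal\<close>, and the categorical branch is dropped when the remaining mass exceeds
  1.\<close>

lemma emeasure_token_law:
  fixes P :: "'w::{finite,linorder} \<Rightarrow> real"
  assumes eps: "0 \<le> eps" "eps \<le> 1" and A: "A \<in> sets obsM"
  shows "emeasure (token_law eps P \<xi>) A =
    ennreal eps * indicator A (\<xi>, gumbel_dec P \<xi>) +
    ennreal (1 - eps) * (if (\<Sum>w\<in>UNIV. ennreal (P w)) \<le> 1 then \<Sum>w\<in>UNIV. ennreal (P w) * indicator A (\<xi>, w) else 0)"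
proof -
  have sp: "space (cat P \<bind> (\<lambda>w. return obsM (\<xi>, w))) = space obsM"
    by (rule sets_eq_imp_space_eq) simp
  have "emeasure (cat P \<bind> (\<lambda>w. return obsM (\<xi>, w))) (space obsM) = (\<Sum>w\<in>UNIV. ennreal (P w))"
    by (subst emeasure_cat_bind_return[OF sets.top]) (simp add: space_pair_measure)
  then have "subprob_space (cat P \<bind> (\<lambda>w. return obsM (\<xi>, w))) \<longleftrightarrow> (\<Sum>w\<in>UNIV. ennreal (P w)) \<le> 1"
    using sp by (auto simp: space_pair_measure dest: subprob_space.emeasure_space_le_1 intro!: subprob_spaceI)
  moreover have "subprob_space (return obsM (\<xi>, gumbel_dec P \<xi>))"
    by (rule subprob_space_return) (simp add: space_pair_measure)
  ultimately show ?thesis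
    unfolding token_law_def token_branches using A eps
    by (subst emeasure_bind_pmf_partial[where N = obsM])
       (auto simp: space_pair_measure emeasure_cat_bind_return mult.commute)
qed

lemma sets_token_law [simp]: "sets (token_law eps P \<xi>) = sets obsM"
  unfolding token_law_def token_branches by (rule sets_bind) auto

lemma subprob_space_token_law:
  fixes P :: "'w::{finite,linorder} \<Rightarrow> real"
  assumes eps: "0 \<le> eps" "eps \<le> 1"
  shows "subprob_space (token_law eps P \<xi>)"
proof (rule subprob_spaceI)
  have sp: "space (token_law eps P \<xi>) = UNIV"
    using sets_eq_imp_space_eq[OF sets_token_law] by (simp add: space_pair_measure)
  then show "space (token_law eps P \<xi>) \<noteq> {}" by simp
  have "UNIV \<in> sets obsM" using sets.top[of "obsM"] by (simp add: space_pair_measure)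
  then have "emeasure (token_law eps P \<xi>) UNIV \<le> ennreal eps * 1 + ennreal (1 - eps) * 1"
    by (subst emeasure_token_law[OF eps])
      (use \<open>UNIV \<in> sets obsM\<close> in \<open>auto intro: mult_left_mono[where b = "1::ennreal", simplified]\<close>)
  also have "\<dots> = 1" using eps by (simp flip: ennreal_plus)
  finally show "emeasure (token_law eps P \<xi>) (space (token_law eps P \<xi>)) \<le> 1" using sp by simp
qed

text \<open>Replaces the \<open>LEAST\<close> by finitely many inequalities between scores, so that
  each event \<open>gumbel_dec P \<xi> = w\<close> is visibly measurable. The last disjunct covers
  vectors without a positive entry, where no token qualifies and the decoder returns a fixed
  default.\<close>

lemma gumbel_dec_eq_iff:
  fixes P :: "'w::{finite,linorder} \<Rightarrow> real" and \<xi>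
  defines "Q \<equiv> \<lambda>w. 0 < P w \<and> (\<forall>v. 0 < P v \<longrightarrow> ln (\<xi> v) / P v \<le> ln (\<xi> w) / P w)"
  shows "gumbel_dec P \<xi> = w \<longleftrightarrow> (Q w \<and> (\<forall>v<w. \<not> Q v)) \<or> ((\<forall>v. \<not> Q v) \<and> w = (LEAST v. False))"
proof (cases "\<exists>v. Q v")
  case True
  have *: "gumbel_dec P \<xi> = Min {v. Q v}"
    unfolding gumbel_dec_def Q_def[symmetric] by (rule Least_Min) (use True in auto)
  have "Min {v. Q v} \<in> {v. Q v}" using True by (intro Min_in) auto
  moreover have "Min {v. Q v} \<le> v" if "Q v" for v using that by (intro Min_le) auto
  ultimately show ?thesis unfolding * using True
    by (metis mem_Collect_eq not_le order.antisym linorder_not_less)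
next
  case False
  then have "Q = (\<lambda>_. False)" by auto
  then show ?thesis unfolding gumbel_dec_def Q_def[symmetric] by auto
qed

lemma measurable_gumbel_dec [measurable]:
  "(\<lambda>(P, \<xi>). gumbel_dec P \<xi>) \<in> measurable (vecM \<Otimes>\<^sub>M vecM) (count_space (UNIV :: 'w::{finite,linorder} set))"
proof -
  have "(\<lambda>(P, \<xi>). gumbel_dec P \<xi>) -` {w} \<inter> space (vecM \<Otimes>\<^sub>M vecM) \<in> sets (vecM \<Otimes>\<^sub>M vecM)" for w :: 'w
  proof -
    have "Measurable.pred (vecM \<Otimes>\<^sub>M vecM) (\<lambda>(P, \<xi>). gumbel_dec P \<xi> = w)"
      unfolding gumbel_dec_eq_iff by measurable
    then show ?thesis
      by (simp add: pred_def vimage_def Int_def case_prod_beta conj_commute)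
  qed
  then show ?thesis
    by (simp add: measurable_count_space_eq2)
qed

lemma measurable_token_law [measurable]:
  assumes eps: "0 \<le> eps" "eps \<le> 1"
  shows "(\<lambda>(P, \<xi>). token_law eps P \<xi>) \<in> measurable (vecM \<Otimes>\<^sub>M vecM)
    (subprob_algebra (obsM :: (('w::{finite,linorder} \<Rightarrow> real) \<times> 'w) measure))"
proof (rule measurable_subprob_algebra)
  fix A :: "(('w \<Rightarrow> real) \<times> 'w) set" assume A[measurable]: "A \<in> sets obsM"
  have *: "(\<lambda>x. indicator A (snd x, w) :: ennreal) \<in> borel_measurable ((vecM :: ('w \<Rightarrow> real) measure) \<Otimes>\<^sub>M vecM)" for w
    by measurable
  have "(\<lambda>x. indicator A (snd x, case_prod gumbel_dec x) :: ennreal) \<in> borel_measurable (vecM \<Otimes>\<^sub>M vecM)"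
    by measurable
  then have **: "(\<lambda>x. indicator A (snd x, gumbel_dec (fst x) (snd x)) :: ennreal) \<in> borel_measurable (vecM \<Otimes>\<^sub>M vecM)"
    by (simp add: case_prod_beta')
  note [measurable] = * **
  show "(\<lambda>x. emeasure (case_prod (token_law eps) x) A) \<in> borel_measurable (vecM \<Otimes>\<^sub>M vecM)"
    by (simp add: case_prod_beta emeasure_token_law[OF eps A])
qed (auto simp: subprob_space_token_law[OF eps])

lemma step_law_eq: "step_law eps P = xi_law \<bind> token_law eps P"
  unfolding step_law_def token_law_def ..

lemma measurable_step_law [measurable]:
  assumes eps: "0 \<le> eps" "eps \<le> 1"
  shows "step_law eps \<in> measurable vecM (subprob_algebra (obsM :: (('w::{finite,linorder} \<Rightarrow> real) \<times> 'w) measure))"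
proof -
  interpret xi: prob_space "xi_law :: ('w \<Rightarrow> real) measure" by (rule prob_space_xi_law)
  have "(\<lambda>P. xi_law \<bind> token_law eps P) \<in> measurable vecM (subprob_algebra (obsM :: (('w::{finite,linorder} \<Rightarrow> real) \<times> 'w) measure))"
    by (rule measurable_bind[where N = vecM])
       (use measurable_token_law[OF eps] in \<open>auto simp: case_prod_beta' space_subprob_algebra xi.subprob_space_axioms\<close>)
  then show ?thesis by (simp add: step_law_eq[abs_def])
qed

section \<open>One step of the watermark model\<close>

lemma probvec_sum_ennreal:
  assumes "probvec P" shows "(\<Sum>w\<in>UNIV. ennreal (P w)) = 1"
  using assms by (simp add: probvec_def sum_ennreal)

lemma probvec_sum_support:
  assumes "probvec P" shows "(\<Sum>w | 0 < P w. P w) = 1"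
proof -
  have "(\<Sum>w | 0 < P w. P w) = sum P UNIV"
    using assms by (intro sum.mono_neutral_left) (auto simp: probvec_def not_less intro: antisym)
  then show ?thesis using assms by (simp add: probvec_def)
qed

text \<open>For a probability vector both branches have mass 1, so none is dropped and the ordinary
  integral formula for \<open>bind\<close> applies.\<close>

lemma nn_integral_token_law:
  fixes P :: "'w::{finite,linorder} \<Rightarrow> real"
  assumes P: "probvec P" and eps: "0 \<le> eps" "eps \<le> 1"
    and g[measurable]: "g \<in> borel_measurable obsM"
  shows "(\<integral>\<^sup>+x. g x \<partial>token_law eps P \<xi>) =
    ennreal eps * g (\<xi>, gumbel_dec P \<xi>) + ennreal (1 - eps) * (\<Sum>w\<in>UNIV. ennreal (P w) * g (\<xi>, w))"
proof -
  let ?cat = "cat P \<bind> (\<lambda>w. return obsM (\<xi>, w))"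
  have sp: "space ?cat = space obsM"
    by (rule sets_eq_imp_space_eq) simp
  have "emeasure ?cat (space obsM) = 1"
    by (subst emeasure_cat_bind_return[OF sets.top])
       (simp add: space_pair_measure probvec_sum_ennreal[OF P])
  then have "subprob_space ?cat"
    using sp by (auto simp: space_pair_measure intro!: subprob_spaceI)
  moreover have "subprob_space (return obsM (\<xi>, gumbel_dec P \<xi>))"
    by (rule subprob_space_return) (simp add: space_pair_measure)
  ultimately have *: "(\<lambda>b. if b then return obsM (\<xi>, gumbel_dec P \<xi>) else ?cat)
      \<in> measurable (measure_pmf (bernoulli_pmf eps)) (subprob_algebra obsM)"
    by (simp add: space_subprob_algebra)
  have "(\<integral>\<^sup>+x. g x \<partial>?cat) = (\<Sum>w\<in>UNIV. ennreal (P w) * g (\<xi>, w))"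
    by (subst nn_integral_bind[OF g measurable_return_obsM_cat])
       (simp add: nn_integral_return space_pair_measure nn_integral_cat)
  then show ?thesis
    unfolding token_law_def token_branches using eps
    by (subst nn_integral_bind[OF g *]) (simp add: nn_integral_return space_pair_measure mult.commute)
qed

lemma nn_integral_step_law:
  fixes P :: "'w::{finite,linorder} \<Rightarrow> real"
  assumes P: "probvec P" and eps: "0 \<le> eps" "eps \<le> 1"
    and g[measurable]: "g \<in> borel_measurable obsM"
  shows "(\<integral>\<^sup>+x. g x \<partial>step_law eps P) =
    (\<integral>\<^sup>+\<xi>. ennreal eps * g (\<xi>, gumbel_dec P \<xi>) +
       ennreal (1 - eps) * (\<Sum>w\<in>UNIV. ennreal (P w) * g (\<xi>, w)) \<partial>xi_law)"
proof -
  have "token_law eps P \<in> measurable xi_law (subprob_algebra obsM)"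
    using measurable_compose[OF measurable_Pair1'[of P vecM vecM] measurable_token_law[OF eps]]
    by (simp cong: measurable_cong_sets)
  then show ?thesis
    unfolding step_law_eq by (simp add: nn_integral_bind[OF g] nn_integral_token_law[OF P eps g])
qed

lemma prob_space_step_law:
  fixes P :: "'w::{finite,linorder} \<Rightarrow> real"
  assumes P: "probvec P" and eps: "0 \<le> eps" "eps \<le> 1"
  shows "prob_space (step_law eps P)"
proof
  interpret xi: prob_space "xi_law :: ('w \<Rightarrow> real) measure" by (rule prob_space_xi_law)
  have "emeasure (step_law eps P) (space (step_law eps P)) = (\<integral>\<^sup>+x. 1 \<partial>step_law eps P)"
    by simp
  also have "\<dots> = 1"
    using eps by (subst nn_integral_step_law[OF P eps])
      (simp_all add: probvec_sum_ennreal[OF P] xi.emeasure_space_1[simplified] flip: ennreal_plus)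
  finally show "emeasure (step_law eps P) (space (step_law eps P)) = 1" .
qed

section \<open>Distribution of the uniform entry at the decoded token\<close>

lemma nn_integral_unif01:
  assumes [measurable]: "g \<in> borel_measurable borel"
  shows "(\<integral>\<^sup>+u. g u \<partial>unif01) = (\<integral>\<^sup>+u. g u * indicator {0..1} u \<partial>lborel)"
  unfolding unif01_def by (subst nn_integral_uniform_measure) (auto simp: divide_ennreal_def)

lemma AE_unif01: "AE u in unif01. 0 < u \<and> u \<le> 1"
proof -
  have "AE u in lborel. (u::real) \<noteq> 0" by (rule AE_lborel_singleton)
  then show ?thesis unfolding unif01_def
    by (subst AE_uniform_measure) auto
qed

lemma emeasure_unif01_atMost:
  assumes "0 \<le> r" "r \<le> 1" shows "emeasure unif01 {..r} = ennreal r"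
proof -
  have "{0..1} \<inter> {..r} = {0..r}" using assms by auto
  then show ?thesis using assms unfolding unif01_def by (simp add: divide_ennreal_def)
qed

lemma nn_integral_xi_law_component:
  assumes [measurable]: "g \<in> borel_measurable borel"
  shows "(\<integral>\<^sup>+\<xi>. g (\<xi> w) \<partial>(xi_law :: ('w \<Rightarrow> real) measure)) = (\<integral>\<^sup>+u. g u \<partial>unif01)"
proof -
  interpret product_prob_space "\<lambda>_::'w. unif01" UNIV
    by (intro product_prob_spaceI prob_space_unif01)
  have "(\<integral>\<^sup>+u. g u \<partial>distr xi_law unif01 (\<lambda>\<xi>. \<xi> w)) = (\<integral>\<^sup>+\<xi>. g (\<xi> w) \<partial>xi_law)"
    unfolding xi_law_def by (rule nn_integral_distr[OF measurable_component_singleton])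
      (simp_all cong: measurable_cong_sets)
  then show ?thesis unfolding xi_law_def by (simp add: PiM_component)
qed

text \<open>The derivative in \<open>u\<close> of the Gumbel-max CDF
  \<open>\<Sum>w. P w * u powr (1 / P w)\<close>. The sum runs over positive entries only, since the
  other tokens are never decoded and \<open>1 / 0 = 0\<close> would add a spurious term
  \<open>u powr (-1)\<close>.\<close>

definition gumbel_dens :: "('w::finite \<Rightarrow> real) \<Rightarrow> real \<Rightarrow> real"
  where "gumbel_dens P u = (\<Sum>w | 0 < P w. u powr (1 / P w - 1))"

lemma measurable_gumbel_dens [measurable]: "gumbel_dens P \<in> borel_measurable borel"
  unfolding gumbel_dens_def[abs_def] by measurable

lemma gumbel_dens_nonneg: "0 \<le> gumbel_dens P u"
  unfolding gumbel_dens_def by (intro sum_nonneg) simp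

lemma sets_score_le: "{x::real. 0 < p \<longrightarrow> ln x / p \<le> c} \<in> sets borel"
proof (cases "0 < p")
  case True
  have "(\<lambda>x. ln x / p) \<in> borel_measurable borel"
    by (intro borel_measurable_divide borel_measurable_ln measurable_ident_sets borel_measurable_const) simp
  from borel_measurable_le[OF this borel_measurable_const[of c]] True show ?thesis
    by simp
qed simp

text \<open>Almost surely \<open>x\<close> is positive, and exponentiating turns the score
  comparison into \<open>x \<le> u powr (p / r)\<close>. For \<open>p = 0\<close> the comparison is
  void and the bound is \<open>u powr 0 = 1\<close>.\<close>

lemma emeasure_unif01_score_le:
  assumes "0 < u" "u \<le> 1" "0 \<le> p" "0 < r"
  shows "emeasure unif01 {x. 0 < p \<longrightarrow> ln x / p \<le> ln u / r} \<le> ennreal (u powr (p / r))"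
proof (cases "p = 0")
  case True
  then show ?thesis using assms prob_space.emeasure_space_1[OF prob_space_unif01] by simp
next
  case False
  then have p: "0 < p" using assms by simp
  have le1: "u powr (p / r) \<le> 1"
    using assms p powr_mono2[of "p / r" u 1] by simp
  have "emeasure unif01 {x. 0 < p \<longrightarrow> ln x / p \<le> ln u / r} \<le> emeasure unif01 {.. u powr (p / r)}"
  proof (rule emeasure_mono_AE)
    show "AE x in unif01. x \<in> {x. 0 < p \<longrightarrow> ln x / p \<le> ln u / r} \<longrightarrow> x \<in> {.. u powr (p / r)}"
      using AE_unif01
    proof eventually_elim
      case (elim x)
      have "x \<le> u powr (p / r)" if "ln x / p \<le> ln u / r"
      proof -
        have "ln x \<le> (p / r) * ln u" using that p by (simp add: field_simps)
        then have "exp (ln x) \<le> exp ((p / r) * ln u)" by simp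
        then show ?thesis using elim assms by (simp add: powr_def)
      qed
      then show ?case using p by auto
    qed
  qed simp
  also have "\<dots> = ennreal (u powr (p / r))"
    using le1 by (intro emeasure_unif01_atMost) auto
  finally show ?thesis .
qed

lemma measurable_winning_integrand:
  fixes P :: "'w::finite \<Rightarrow> real" and g :: "real \<Rightarrow> ennreal"
  assumes g: "g \<in> borel_measurable borel"
  shows "(\<lambda>\<xi>. g (\<xi> w) * (\<Prod>v\<in>UNIV - {w}. indicator {x. 0 < P v \<longrightarrow> ln x / P v \<le> ln (\<xi> w) / P w} (\<xi> v)))
    \<in> borel_measurable xi_law"
proof -
  have m: "(\<lambda>\<xi>. ln (\<xi> v) / P v) \<in> borel_measurable vecM" for v
    by (intro borel_measurable_divide borel_measurable_ln measurable_vecM_apply borel_measurable_const)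
  have "(\<lambda>\<xi>. indicator {x. 0 < P v \<longrightarrow> ln x / P v \<le> ln (\<xi> w) / P w} (\<xi> v) :: ennreal) \<in> borel_measurable vecM" for v
  proof (cases "0 < P v")
    case True
    then have "(\<lambda>\<xi>. indicator {x. 0 < P v \<longrightarrow> ln x / P v \<le> ln (\<xi> w) / P w} (\<xi> v) :: ennreal) =
      indicator {\<xi> \<in> space vecM. ln (\<xi> v) / P v \<le> ln (\<xi> w) / P w}"
      by (simp add: indicator_def fun_eq_iff)
    then show ?thesis
      using borel_measurable_indicator[OF borel_measurable_le[OF m m]] by simp
  qed simp
  then have "(\<lambda>\<xi>. g (\<xi> w) * (\<Prod>v\<in>UNIV - {w}. indicator {x. 0 < P v \<longrightarrow> ln x / P v \<le> ln (\<xi> w) / P w} (\<xi> v)))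
    \<in> borel_measurable vecM"
    by (intro borel_measurable_times_ennreal borel_measurable_prod_ennreal measurable_compose[OF measurable_vecM_apply g])
  then show ?thesis
    using measurable_cong_sets[OF sets_xi_law refl] by blast
qed

lemma prod_mono_ennreal:
  fixes f g :: "'a \<Rightarrow> ennreal"
  shows "(\<And>i. i \<in> A \<Longrightarrow> f i \<le> g i) \<Longrightarrow> prod f A \<le> prod g A"
  by (induct A rule: infinite_finite_induct) (auto intro!: mult_mono)

text \<open>By independence the probability that every other token scores at most as high as
  \<open>w\<close> factorises into powers of \<open>u\<close>; the exponents
  \<open>P v / P w\<close> add up to \<open>(1 - P w) / P w = 1 / P w - 1\<close>.\<close>

lemma nn_integral_losing_tokens_le:
  fixes P :: "'w::finite \<Rightarrow> real"
  assumes P: "probvec P" and w: "0 < P w" and u: "0 < u" "u \<le> 1"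
  shows "(\<integral>\<^sup>+\<xi>. (\<Prod>v\<in>UNIV - {w}. indicator {x. 0 < P v \<longrightarrow> ln x / P v \<le> ln u / P w} (\<xi> v))
      \<partial>Pi\<^sub>M (UNIV - {w}) (\<lambda>_. unif01)) \<le> ennreal (u powr (1 / P w - 1))"
proof -
  have "(\<Sum>v\<in>UNIV - {w}. P v / P w) = sum P (UNIV - {w}) / P w"
    by (rule sum_divide_distrib[symmetric])
  also have "sum P (UNIV - {w}) = 1 - P w"
    using P by (simp add: probvec_def sum_diff1)
  also have "(1 - P w) / P w = 1 / P w - 1"
    using w by (simp add: diff_divide_distrib)
  finally have sum: "(\<Sum>v\<in>UNIV - {w}. P v / P w) = 1 / P w - 1" .
  have "(\<integral>\<^sup>+\<xi>. (\<Prod>v\<in>UNIV - {w}. indicator {x. 0 < P v \<longrightarrow> ln x / P v \<le> ln u / P w} (\<xi> v))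
      \<partial>Pi\<^sub>M (UNIV - {w}) (\<lambda>_. unif01)) =
    (\<Prod>v\<in>UNIV - {w}. (\<integral>\<^sup>+x. indicator {x. 0 < P v \<longrightarrow> ln x / P v \<le> ln u / P w} x \<partial>unif01))"
    by (rule product_sigma_finite.product_nn_integral_prod[OF product_sigma_finite_unif01,
          where f = "\<lambda>v. indicator {x. 0 < P v \<longrightarrow> ln x / P v \<le> ln u / P w}"])
      (simp_all add: sets_score_le borel_measurable_indicator)
  also have "\<dots> \<le> (\<Prod>v\<in>UNIV - {w}. ennreal (u powr (P v / P w)))"
    using u P w by (intro prod_mono_ennreal) (simp add: probvec_def sets_score_le emeasure_unif01_score_le)
  also have "\<dots> = ennreal (u powr (\<Sum>v\<in>UNIV - {w}. P v / P w))"
    using u by (simp add: prod_ennreal powr_sum)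
  finally show ?thesis
    unfolding sum .
qed

text \<open>Fubini: the coordinate \<open>w\<close> is frozen at \<open>u\<close> and the others are
  integrated first. The product of indicators is the event that no token of positive probability
  beats \<open>w\<close>.\<close>

lemma nn_integral_winning_token_le:
  fixes P :: "'w::finite \<Rightarrow> real"
  assumes P: "probvec P" and w: "0 < P w" and g[measurable]: "g \<in> borel_measurable borel"
  shows "(\<integral>\<^sup>+\<xi>. g (\<xi> w) * (\<Prod>v\<in>UNIV - {w}. indicator {x. 0 < P v \<longrightarrow> ln x / P v \<le> ln (\<xi> w) / P w} (\<xi> v)) \<partial>xi_law)
    \<le> (\<integral>\<^sup>+u. g u * ennreal (u powr (1 / P w - 1)) \<partial>unif01)"
proof -
  define S where "S v u = {x. 0 < P v \<longrightarrow> ln x / P v \<le> ln u / P w}" for v u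
  define F where "F \<xi> = g (\<xi> w) * (\<Prod>v\<in>UNIV - {w}. indicator (S v (\<xi> w)) (\<xi> v))" for \<xi>
  have ins: "insert w (UNIV - {w}) = UNIV" by auto
  have S[measurable]: "S v u \<in> sets borel" for v u
    unfolding S_def by (rule sets_score_le)
  have F: "F \<in> borel_measurable xi_law"
    using measurable_winning_integrand[OF g, of w P] unfolding F_def[abs_def] S_def .
  have F_upd: "F (\<xi>(w := u)) = g u * (\<Prod>v\<in>UNIV - {w}. indicator (S v u) (\<xi> v))" for \<xi> u
    unfolding F_def by (auto intro!: arg_cong2[where f = "(*)"] prod.cong)
  have le: "(\<integral>\<^sup>+\<xi>. F (\<xi>(w := u)) \<partial>Pi\<^sub>M (UNIV - {w}) (\<lambda>_. unif01)) \<le> g u * ennreal (u powr (1 / P w - 1))"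
    if u: "0 < u" "u \<le> 1" for u
  proof -
    have "(\<integral>\<^sup>+\<xi>. F (\<xi>(w := u)) \<partial>Pi\<^sub>M (UNIV - {w}) (\<lambda>_. unif01)) =
      g u * (\<integral>\<^sup>+\<xi>. (\<Prod>v\<in>UNIV - {w}. indicator (S v u) (\<xi> v)) \<partial>Pi\<^sub>M (UNIV - {w}) (\<lambda>_. unif01))"
      unfolding F_upd
      by (intro nn_integral_cmult borel_measurable_prod_ennreal measurable_compose[OF measurable_component_singleton])
        (simp_all cong: measurable_cong_sets)
    then show ?thesis
      using nn_integral_losing_tokens_le[OF P w u] by (simp add: S_def mult_left_mono)
  qed
  have "(\<integral>\<^sup>+\<xi>. F \<xi> \<partial>xi_law) = (\<integral>\<^sup>+u. \<integral>\<^sup>+\<xi>. F (\<xi>(w := u)) \<partial>Pi\<^sub>M (UNIV - {w}) (\<lambda>_. unif01) \<partial>unif01)"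
    using product_sigma_finite.product_nn_integral_insert_rev[OF product_sigma_finite_unif01, of "UNIV - {w}" w F] F
    unfolding ins xi_law_def by simp
  also have "\<dots> \<le> (\<integral>\<^sup>+u. g u * ennreal (u powr (1 / P w - 1)) \<partial>unif01)"
    by (rule nn_integral_mono_AE) (rule eventually_mono[OF AE_unif01], simp add: le)
  finally show ?thesis unfolding F_def S_def .
qed

text \<open>The set of tokens of positive probability is finite and nonempty, so a maximal score
  exists and the \<open>LEAST\<close> is attained.\<close>

lemma gumbel_dec_optimal:
  fixes P :: "'w::{finite,linorder} \<Rightarrow> real"
  assumes P: "probvec P"
  shows "0 < P (gumbel_dec P \<xi>)"
    and "0 < P v \<Longrightarrow> ln (\<xi> v) / P v \<le> ln (\<xi> (gumbel_dec P \<xi>)) / P (gumbel_dec P \<xi>)"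
proof -
  let ?S = "{w. 0 < P w}"
  have "?S \<noteq> {}"
  proof
    assume "?S = {}"
    then have "P w \<le> 0" for w by (metis empty_iff mem_Collect_eq not_less)
    then have "sum P UNIV \<le> 0" by (intro sum_nonpos) auto
    then show False using P by (simp add: probvec_def)
  qed
  let ?m = "Max ((\<lambda>w. ln (\<xi> w) / P w) ` ?S)"
  have "?m \<in> (\<lambda>w. ln (\<xi> w) / P w) ` ?S"
    using \<open>?S \<noteq> {}\<close> by (intro Max_in) auto
  then obtain w where "0 < P w" "?m = ln (\<xi> w) / P w" by auto
  moreover have "ln (\<xi> v) / P v \<le> ?m" if "0 < P v" for v
    using that by (intro Max_ge) auto
  ultimately have ex: "\<exists>w. 0 < P w \<and> (\<forall>v. 0 < P v \<longrightarrow> ln (\<xi> v) / P v \<le> ln (\<xi> w) / P w)"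
    by metis
  let ?Q = "\<lambda>w. 0 < P w \<and> (\<forall>v. 0 < P v \<longrightarrow> ln (\<xi> v) / P v \<le> ln (\<xi> w) / P w)"
  have "gumbel_dec P \<xi> = Min {w. ?Q w}"
    unfolding gumbel_dec_def by (rule Least_Min) (use ex in auto)
  moreover have "Min {w. ?Q w} \<in> {w. ?Q w}"
    using ex by (intro Min_in) auto
  ultimately have "?Q (gumbel_dec P \<xi>)" by simp
  then show "0 < P (gumbel_dec P \<xi>)"
    and "0 < P v \<Longrightarrow> ln (\<xi> v) / P v \<le> ln (\<xi> (gumbel_dec P \<xi>)) / P (gumbel_dec P \<xi>)"
    by auto
qed

text \<open>The decoded token passes all its comparisons, so the integrand is one of the terms
  \<open>?F w\<close> and is at most their sum. At a tie several terms count at once, which the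
  direction of the inequality allows.\<close>

lemma nn_integral_gumbel_dec_le:
  fixes P :: "'w::{finite,linorder} \<Rightarrow> real"
  assumes P: "probvec P" and g[measurable]: "g \<in> borel_measurable borel"
  shows "(\<integral>\<^sup>+\<xi>. g (\<xi> (gumbel_dec P \<xi>)) \<partial>xi_law) \<le> (\<integral>\<^sup>+u. g u * ennreal (gumbel_dens P u) \<partial>unif01)"
proof -
  let ?F = "\<lambda>w \<xi>. g (\<xi> w) * (\<Prod>v\<in>UNIV - {w}. indicator {x. 0 < P v \<longrightarrow> ln x / P v \<le> ln (\<xi> w) / P w} (\<xi> v))"
  have F: "?F w \<in> borel_measurable xi_law" for w
    by (rule measurable_winning_integrand) fact
  have "(\<integral>\<^sup>+\<xi>. g (\<xi> (gumbel_dec P \<xi>)) \<partial>xi_law) \<le> (\<integral>\<^sup>+\<xi>. (\<Sum>w | 0 < P w. ?F w \<xi>) \<partial>xi_law)"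
  proof (rule nn_integral_mono)
    fix \<xi> :: "'w \<Rightarrow> real"
    let ?w = "gumbel_dec P \<xi>"
    have "g (\<xi> ?w) = ?F ?w \<xi>"
      using gumbel_dec_optimal(2)[OF P, of _ \<xi>] by simp
    also have "\<dots> \<le> (\<Sum>w | 0 < P w. ?F w \<xi>)"
      using gumbel_dec_optimal(1)[OF P, of \<xi>] by (intro member_le_sum[where f = "\<lambda>w. ?F w \<xi>"]) auto
    finally show "g (\<xi> ?w) \<le> (\<Sum>w | 0 < P w. ?F w \<xi>)" .
  qed
  also have "\<dots> = (\<Sum>w | 0 < P w. \<integral>\<^sup>+\<xi>. ?F w \<xi> \<partial>xi_law)"
    by (rule nn_integral_sum) (rule F)
  also have "\<dots> \<le> (\<Sum>w | 0 < P w. \<integral>\<^sup>+u. g u * ennreal (u powr (1 / P w - 1)) \<partial>unif01)"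
    by (intro sum_mono nn_integral_winning_token_le[OF P]) auto
  also have "\<dots> = (\<integral>\<^sup>+u. (\<Sum>w | 0 < P w. g u * ennreal (u powr (1 / P w - 1))) \<partial>unif01)"
    by (subst nn_integral_sum) (simp_all cong: measurable_cong_sets)
  also have "\<dots> = (\<integral>\<^sup>+u. g u * ennreal (gumbel_dens P u) \<partial>unif01)"
    by (simp add: gumbel_dens_def flip: sum_distrib_left sum_ennreal)
  finally show ?thesis .
qed

definition mix_dens :: "real \<Rightarrow> ('w::finite \<Rightarrow> real) \<Rightarrow> real \<Rightarrow> real"
  where "mix_dens eps P u = 1 - eps + eps * gumbel_dens P u"

lemma measurable_mix_dens [measurable]: "mix_dens eps P \<in> borel_measurable borel"
  unfolding mix_dens_def[abs_def] by measurable

lemma measurable_observed [measurable]: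
  "(\<lambda>(\<xi>, w). \<xi> w) \<in> borel_measurable (obsM :: (('w::finite \<Rightarrow> real) \<times> 'w) measure)"
proof -
  have "(\<lambda>x. (\<Sum>w\<in>UNIV. if snd x = w then fst x w else 0)) \<in> borel_measurable (obsM :: (('w \<Rightarrow> real) \<times> 'w) measure)"
    by measurable
  then show ?thesis by (simp add: case_prod_beta')
qed

text \<open>The decoder branch contributes \<open>gumbel_dens\<close>. In the other branch the token
  is drawn without looking at \<open>\<xi>\<close>, so the observed entry stays uniform and
  contributes the constant density 1.\<close>

lemma nn_integral_step_law_le:
  fixes P :: "'w::{finite,linorder} \<Rightarrow> real"
  assumes P: "probvec P" and eps: "0 \<le> eps" "eps \<le> 1"
    and g[measurable]: "g \<in> borel_measurable borel"
  shows "(\<integral>\<^sup>+(\<xi>, w). g (\<xi> w) \<partial>step_law eps P) \<le> (\<integral>\<^sup>+u. g u * ennreal (mix_dens eps P u) \<partial>unif01)"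
proof -
  have obs[measurable]: "(\<lambda>(\<xi>, w). g (\<xi> w)) \<in> borel_measurable (obsM :: (('w \<Rightarrow> real) \<times> 'w) measure)"
    using measurable_compose[OF measurable_observed g] by (simp add: case_prod_beta')
  have "(\<lambda>\<xi>. (\<xi>, gumbel_dec P \<xi>)) \<in> measurable xi_law obsM"
    using measurable_compose[OF measurable_Pair1'[of P vecM vecM] measurable_gumbel_dec]
    by (intro measurable_Pair) (simp_all cong: measurable_cong_sets)
  from measurable_compose[OF this obs]
  have [measurable]: "(\<lambda>\<xi>. g (\<xi> (gumbel_dec P \<xi>))) \<in> borel_measurable xi_law" by simp
  let ?G = "\<integral>\<^sup>+\<xi>. g (\<xi> (gumbel_dec P \<xi>)) \<partial>xi_law"
  let ?U = "\<integral>\<^sup>+u. g u \<partial>unif01"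
  let ?H = "\<lambda>\<xi>. \<Sum>w\<in>UNIV. ennreal (P w) * g (\<xi> w)"
  have [measurable]: "?H \<in> borel_measurable xi_law"
    by (simp cong: measurable_cong_sets)
  have H: "(\<integral>\<^sup>+\<xi>. ?H \<xi> \<partial>xi_law) = ?U"
  proof -
    have "(\<integral>\<^sup>+\<xi>. ?H \<xi> \<partial>xi_law) = (\<Sum>w\<in>UNIV. ennreal (P w) * (\<integral>\<^sup>+\<xi>. g (\<xi> w) \<partial>xi_law))"
      by (subst nn_integral_sum) (simp_all add: nn_integral_cmult cong: measurable_cong_sets)
    also have "\<dots> = (\<Sum>w\<in>UNIV. ennreal (P w)) * ?U"
      by (simp only: nn_integral_xi_law_component[OF g] sum_distrib_right)
    finally show ?thesis by (simp add: probvec_sum_ennreal[OF P])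
  qed
  have "(\<integral>\<^sup>+(\<xi>, w). g (\<xi> w) \<partial>step_law eps P) =
    (\<integral>\<^sup>+\<xi>. ennreal eps * g (\<xi> (gumbel_dec P \<xi>)) + ennreal (1 - eps) * ?H \<xi> \<partial>xi_law)"
    by (simp add: nn_integral_step_law[OF P eps obs])
  also have "\<dots> = ennreal eps * ?G + ennreal (1 - eps) * ?U"
    by (subst nn_integral_add) (simp_all add: nn_integral_cmult H)
  also have "\<dots> \<le> ennreal eps * (\<integral>\<^sup>+u. g u * ennreal (gumbel_dens P u) \<partial>unif01) + ennreal (1 - eps) * ?U"
    by (intro add_right_mono mult_left_mono nn_integral_gumbel_dec_le[OF P g]) auto
  also have "\<dots> = (\<integral>\<^sup>+u. ennreal eps * (g u * ennreal (gumbel_dens P u)) + ennreal (1 - eps) * g u \<partial>unif01)"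
    by (simp add: nn_integral_add nn_integral_cmult cong: measurable_cong_sets)
  also have "\<dots> = (\<integral>\<^sup>+u. g u * ennreal (mix_dens eps P u) \<partial>unif01)"
  proof (rule nn_integral_cong)
    fix u
    have "ennreal (mix_dens eps P u) = ennreal (1 - eps) + ennreal eps * ennreal (gumbel_dens P u)"
      using eps by (simp add: mix_dens_def gumbel_dens_nonneg flip: ennreal_mult ennreal_plus)
    then show "ennreal eps * (g u * ennreal (gumbel_dens P u)) + ennreal (1 - eps) * g u =
      g u * ennreal (mix_dens eps P u)"
      by (simp add: distrib_left mult_ac add_ac)
  qed
  finally show ?thesis .
qed

section \<open>Laws of the history and of the observations\<close>

lemma measurable_hist_update:
  "(\<lambda>((h, P), xw). h(t := (P, xw))) \<in> measurable ((histM \<Otimes>\<^sub>M vecM) \<Otimes>\<^sub>M obsM) (histM :: (nat \<Rightarrow> ('w::{finite,linorder}) state) measure)"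
proof -
  have "(\<lambda>x. (fst (fst x))(t := (snd (fst x), snd x))) \<in> measurable ((histM \<Otimes>\<^sub>M vecM) \<Otimes>\<^sub>M obsM) (histM :: (nat \<Rightarrow> 'w state) measure)"
    unfolding histM_def stateM_def
    by (rule measurable_fun_upd[where J = UNIV]) (auto simp: stateM_def)
  then show ?thesis by (simp add: case_prod_beta')
qed

text \<open>One sample size at a time: \<open>N\<close> observations with common gap
  \<open>D\<close>. The kernels may depend on the whole history, including the hidden vectors and
  tokens.\<close>

locale gumbel_model =
  fixes eps D :: real and K :: "nat \<Rightarrow> (nat \<Rightarrow> ('w::{finite,linorder}) state) \<Rightarrow> ('w \<Rightarrow> real) measure" and N :: nat
  assumes eps: "0 \<le> eps" "eps \<le> 1"
    and K_meas: "K t \<in> measurable histM (prob_algebra vecM)"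
    and K_probvec: "t < N \<Longrightarrow> AE P in K t h. probvec P \<and> gap P = D"
begin

lemma K_subprob [measurable]: "K t \<in> measurable histM (subprob_algebra vecM)"
  using K_meas by (rule measurable_prob_algebraD)

lemma prob_space_K: "prob_space (K t h)" and sets_K: "sets (K t h) = sets vecM"
  using measurable_space[OF K_meas, of h t] by (auto simp: space_prob_algebra)

lemma measurable_update_kernel:
  "(\<lambda>((h :: nat \<Rightarrow> 'w state, P), xw). return histM (h(t := (P, xw)))) \<in> measurable ((histM \<Otimes>\<^sub>M vecM) \<Otimes>\<^sub>M obsM) (subprob_algebra histM)"
  using measurable_compose[OF measurable_hist_update return_measurable] by (simp add: case_prod_beta')

lemma measurable_token_kernel:
  "(\<lambda>(h :: nat \<Rightarrow> 'w state, P). step_law eps P \<bind> (\<lambda>xw. return histM (h(t := (P, xw))))) \<in> measurable (histM \<Otimes>\<^sub>M vecM) (subprob_algebra histM)"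
proof -
  have "(\<lambda>x :: (nat \<Rightarrow> 'w state) \<times> ('w \<Rightarrow> real). step_law eps (snd x) \<bind> (\<lambda>xw. return histM ((fst x)(t := (snd x, xw))))) \<in> measurable (histM \<Otimes>\<^sub>M vecM) (subprob_algebra histM)"
    by (rule measurable_bind[where N = obsM])
      (use measurable_update_kernel measurable_compose[OF measurable_snd measurable_step_law[OF eps]]
       in \<open>simp_all add: case_prod_beta'\<close>)
  then show ?thesis by (simp add: case_prod_beta')
qed

lemma measurable_step_kernel:
  "(\<lambda>h. K t h \<bind> (\<lambda>P. step_law eps P \<bind> (\<lambda>xw. return histM (h(t := (P, xw)))))) \<in> measurable histM (subprob_algebra histM)"
  by (rule measurable_bind[OF K_subprob]) (use measurable_token_kernel in \<open>simp add: case_prod_beta'\<close>)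

lemma sets_hist: "sets (hist eps K t) = sets histM"
proof (induction t)
  case (Suc t)
  then have "space (hist eps K t) = UNIV"
    using sets_eq_imp_space_eq[OF Suc] by simp
  moreover have "sets (K t h \<bind> (\<lambda>P. step_law eps P \<bind> (\<lambda>xw. return histM (h(t := (P, xw)))))) = sets histM" for h
    using subprob_measurableD(2)[OF measurable_step_kernel, of h t] by simp
  ultimately show ?case by (auto intro: sets_bind)
qed simp

text \<open>The tower property for the last time step, obtained by opening the nested binds of
  \<open>hist\<close> from the outside in.\<close>

lemma nn_integral_hist_Suc:
  fixes F :: "(nat \<Rightarrow> 'w state) \<Rightarrow> ennreal"
  assumes F[measurable]: "F \<in> borel_measurable histM"
  shows "(\<integral>\<^sup>+h. F h \<partial>hist eps K (Suc t)) =
    (\<integral>\<^sup>+h. \<integral>\<^sup>+P. \<integral>\<^sup>+xw. F (h(t := (P, xw))) \<partial>step_law eps P \<partial>K t h \<partial>hist eps K t)"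
proof -
  have "(\<integral>\<^sup>+h. F h \<partial>hist eps K (Suc t)) =
    (\<integral>\<^sup>+h. \<integral>\<^sup>+h'. F h' \<partial>(K t h \<bind> (\<lambda>P. step_law eps P \<bind> (\<lambda>xw. return histM (h(t := (P, xw)))))) \<partial>hist eps K t)"
    using measurable_step_kernel[of t]
    by (simp, subst nn_integral_bind[OF F]) (simp_all add: sets_hist cong: measurable_cong_sets)
  also have "\<dots> = (\<integral>\<^sup>+h. \<integral>\<^sup>+P. \<integral>\<^sup>+h'. F h' \<partial>(step_law eps P \<bind> (\<lambda>xw. return histM (h(t := (P, xw))))) \<partial>K t h \<partial>hist eps K t)"
  proof (rule nn_integral_cong, rule nn_integral_bind[OF F])
    fix h :: "nat \<Rightarrow> 'w state"
    have "(\<lambda>P. step_law eps P \<bind> (\<lambda>xw. return histM (h(t := (P, xw))))) \<in> measurable vecM (subprob_algebra histM)"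
      using measurable_compose[OF measurable_Pair1'[of h histM vecM] measurable_token_kernel[of t]] by simp
    then show "(\<lambda>P. step_law eps P \<bind> (\<lambda>xw. return histM (h(t := (P, xw))))) \<in> measurable (K t h) (subprob_algebra histM)"
      by (simp add: sets_K cong: measurable_cong_sets)
  qed
  also have "\<dots> = (\<integral>\<^sup>+h. \<integral>\<^sup>+P. \<integral>\<^sup>+xw. F (h(t := (P, xw))) \<partial>step_law eps P \<partial>K t h \<partial>hist eps K t)"
  proof (intro nn_integral_cong)
    fix h :: "nat \<Rightarrow> 'w state" and P
    have "(\<lambda>xw. return histM (h(t := (P, xw)))) \<in> measurable obsM (subprob_algebra histM)"
      using measurable_compose[OF measurable_Pair1'[of "(h, P)" "histM \<Otimes>\<^sub>M vecM" obsM] measurable_update_kernel[of t]]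
      by (simp add: space_pair_measure)
    moreover have "sets (step_law eps P) = sets obsM"
      using subprob_measurableD(2)[OF measurable_step_law[OF eps], of P] by simp
    ultimately have "(\<lambda>xw. return histM (h(t := (P, xw)))) \<in> measurable (step_law eps P) (subprob_algebra histM)"
      by (simp cong: measurable_cong_sets)
    from nn_integral_bind[OF F this]
    show "(\<integral>\<^sup>+h'. F h' \<partial>(step_law eps P \<bind> (\<lambda>xw. return histM (h(t := (P, xw)))))) =
      (\<integral>\<^sup>+xw. F (h(t := (P, xw))) \<partial>step_law eps P)"
      by (simp add: nn_integral_return)
  qed
  finally show ?thesis .
qed

text \<open>A vector that is not a probability vector could change the mass in
  \<open>step_law\<close>. Up to time \<open>N\<close> only kernels with index below
  \<open>N\<close> are used, and for these \<open>K_probvec\<close> excludes such vectors almost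
  surely.\<close>

lemma prob_space_hist: "t \<le> N \<Longrightarrow> prob_space (hist eps K t)"
proof (induction t)
  case 0
  then show ?case by (simp add: prob_space_return)
next
  case (Suc t)
  interpret prob_space "hist eps K t" using Suc by simp
  have "emeasure (hist eps K (Suc t)) (space (hist eps K (Suc t))) = (\<integral>\<^sup>+h. 1 \<partial>hist eps K (Suc t))"
    by simp
  also have "\<dots> = (\<integral>\<^sup>+h. \<integral>\<^sup>+P. \<integral>\<^sup>+xw. 1 \<partial>step_law eps P \<partial>K t h \<partial>hist eps K t)"
    by (rule nn_integral_hist_Suc) simp
  also have "\<dots> = (\<integral>\<^sup>+h. \<integral>\<^sup>+P. 1 \<partial>K t h \<partial>hist eps K t)"
  proof (rule nn_integral_cong, rule nn_integral_cong_AE)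
    fix h
    show "AE P in K t h. (\<integral>\<^sup>+xw. 1 \<partial>step_law eps P) = 1"
      using K_probvec[of t h] Suc.prems
      by (auto elim!: eventually_mono dest!: prob_space_step_law[OF _ eps] simp: prob_space.emeasure_space_1)
  qed
  also have "\<dots> = 1"
    using prob_space.emeasure_space_1[OF prob_space_K] by (simp add: emeasure_space_1)
  finally show ?case by (rule prob_spaceI)
qed

definition Ymap :: "nat \<Rightarrow> (nat \<Rightarrow> 'w state) \<Rightarrow> nat \<Rightarrow> real"
  where "Ymap n h = (\<lambda>t\<in>{..<n}. fst (snd (h t)) (snd (snd (h t))))"

lemma H1law_eq: "H1law eps K n = distr (hist eps K n) (Yspace n) (Ymap n)"
  unfolding H1law_def Ymap_def[abs_def] ..

lemma measurable_Ymap: "Ymap n \<in> measurable histM (Yspace n)"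
proof -
  have "(\<lambda>h. fst (snd (h t)) (snd (snd (h t)))) \<in> borel_measurable (histM :: (nat \<Rightarrow> 'w state) measure)" for t
  proof -
    have "(\<lambda>h::nat \<Rightarrow> 'w state. snd (h t)) \<in> measurable histM obsM"
      unfolding histM_def stateM_def
      by (rule measurable_compose[OF _ measurable_snd]) (rule measurable_component_singleton, simp)
    from measurable_compose[OF this measurable_observed] show ?thesis
      by (simp add: case_prod_beta')
  qed
  then show ?thesis
    unfolding Ymap_def[abs_def] Yspace_def by (intro measurable_restrict) auto
qed

lemma measurable_Ymap_hist: "Ymap n \<in> measurable (hist eps K m) (Yspace n)"
  using measurable_Ymap measurable_cong_sets[OF sets_hist refl] by blast

lemma Ymap_update: "Ymap (Suc n) (h(n := (P, \<xi>, w))) = (Ymap n h)(n := \<xi> w)"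
  by (auto simp: Ymap_def fun_eq_iff restrict_def)

lemma Ymap_in_space: "Ymap n h \<in> space (Yspace n)"
  by (simp add: Ymap_def Yspace_def space_PiM)

lemma sets_H1law: "sets (H1law eps K n) = sets (Yspace n)"
  by (simp add: H1law_def)

lemma prob_space_H1law: "n \<le> N \<Longrightarrow> prob_space (H1law eps K n)"
  unfolding H1law_eq by (intro prob_space.prob_space_distr prob_space_hist measurable_Ymap_hist)

lemma nn_integral_H1law:
  "G \<in> borel_measurable (Yspace n) \<Longrightarrow> (\<integral>\<^sup>+y. G y \<partial>H1law eps K n) = (\<integral>\<^sup>+h. G (Ymap n h) \<partial>hist eps K n)"
  unfolding H1law_eq by (rule nn_integral_distr[OF measurable_Ymap_hist]) simp

end

lemma Yspace_Suc: "Yspace (Suc n) = Pi\<^sub>M (insert n {..<n}) (\<lambda>_. borel)"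
  by (simp add: Yspace_def lessThan_Suc)

lemma measurable_Yspace_update:
  "(\<lambda>(y, u). y(n := u)) \<in> measurable (Yspace n \<Otimes>\<^sub>M borel) (Yspace (Suc n))"
  unfolding Yspace_Suc using measurable_add_dim[of n "{..<n}" "\<lambda>_. borel"] by (simp add: Yspace_def)

lemma measurable_Yspace_update1:
  "y \<in> space (Yspace n) \<Longrightarrow> (\<lambda>u. y(n := u)) \<in> measurable borel (Yspace (Suc n))"
  using measurable_compose[OF measurable_Pair1'[of y "Yspace n" borel] measurable_Yspace_update[of n]] by simp

context gumbel_model
begin

text \<open>The engine of both inductions over time. The next vector may depend on hidden parts of
  the history and not only on past observations, but a bound that is uniform over all admissible
  \<open>P\<close> involves \<open>y\<close> alone. The last observation can thus be integrated out
  although the observations are neither independent nor Markov in general.\<close>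

lemma nn_integral_H1law_Suc_le:
  assumes n: "n < N"
    and G[measurable]: "G \<in> borel_measurable (Yspace (Suc n))" and H[measurable]: "H \<in> borel_measurable (Yspace n)"
    and le: "\<And>y P. y \<in> space (Yspace n) \<Longrightarrow> probvec P \<Longrightarrow> gap (P :: 'w \<Rightarrow> real) = D \<Longrightarrow>
      (\<integral>\<^sup>+u. G (y(n := u)) * ennreal (mix_dens eps P u) \<partial>unif01) \<le> H y"
  shows "(\<integral>\<^sup>+y. G y \<partial>H1law eps K (Suc n)) \<le> (\<integral>\<^sup>+y. H y \<partial>H1law eps K n)"
proof -
  have "(\<integral>\<^sup>+y. G y \<partial>H1law eps K (Suc n)) = (\<integral>\<^sup>+h. G (Ymap (Suc n) h) \<partial>hist eps K (Suc n))"
    by (rule nn_integral_H1law[OF G])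
  also have "\<dots> = (\<integral>\<^sup>+h. \<integral>\<^sup>+P. \<integral>\<^sup>+xw. G (Ymap (Suc n) (h(n := (P, xw)))) \<partial>step_law eps P \<partial>K n h \<partial>hist eps K n)"
    by (rule nn_integral_hist_Suc) (rule measurable_compose[OF measurable_Ymap G])
  also have "\<dots> \<le> (\<integral>\<^sup>+h. H (Ymap n h) \<partial>hist eps K n)"
  proof (rule nn_integral_mono)
    fix h
    interpret Kh: prob_space "K n h" by (rule prob_space_K)
    have "(\<integral>\<^sup>+P. \<integral>\<^sup>+xw. G (Ymap (Suc n) (h(n := (P, xw)))) \<partial>step_law eps P \<partial>K n h) \<le> (\<integral>\<^sup>+P. H (Ymap n h) \<partial>K n h)"
    proof (rule nn_integral_mono_AE, rule eventually_mono[OF K_probvec[OF n]], elim conjE)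
      fix P :: "'w \<Rightarrow> real" assume P: "probvec P" "gap P = D"
      let ?g = "\<lambda>u. G ((Ymap n h)(n := u))"
      have g: "?g \<in> borel_measurable borel"
        by (rule measurable_compose[OF measurable_Yspace_update1[OF Ymap_in_space] G])
      have "(\<integral>\<^sup>+xw. G (Ymap (Suc n) (h(n := (P, xw)))) \<partial>step_law eps P) = (\<integral>\<^sup>+(\<xi>, w). ?g (\<xi> w) \<partial>step_law eps P)"
        by (rule nn_integral_cong) (auto simp: Ymap_update)
      also have "\<dots> \<le> (\<integral>\<^sup>+u. ?g u * ennreal (mix_dens eps P u) \<partial>unif01)"
        by (rule nn_integral_step_law_le[OF P(1) eps g])
      also have "\<dots> \<le> H (Ymap n h)"
        by (rule le[OF Ymap_in_space P])
      finally show "(\<integral>\<^sup>+xw. G (Ymap (Suc n) (h(n := (P, xw)))) \<partial>step_law eps P) \<le> H (Ymap n h)" .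
    qed
    also have "\<dots> = H (Ymap n h)" by (simp add: Kh.emeasure_space_1)
    finally show "(\<integral>\<^sup>+P. \<integral>\<^sup>+xw. G (Ymap (Suc n) (h(n := (P, xw)))) \<partial>step_law eps P \<partial>K n h) \<le> H (Ymap n h)" .
  qed
  also have "\<dots> = (\<integral>\<^sup>+y. H y \<partial>H1law eps K n)"
    by (rule nn_integral_H1law[OF H, symmetric])
  finally show ?thesis .
qed

end

section \<open>Second moments\<close>

lemma nn_integral_unif01_powr_atMost:
  assumes a: "0 \<le> a" and r: "0 \<le> r" "r \<le> 1"
  shows "(\<integral>\<^sup>+u. ennreal (u powr a) * indicator {..r} u \<partial>unif01) = ennreal (r powr (a + 1) / (a + 1))"
proof -
  have "(\<integral>\<^sup>+u. ennreal (u powr a) * indicator {..r} u \<partial>unif01) =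
      (\<integral>\<^sup>+u. ennreal (u powr a) * indicator {..r} u * indicator {0..1} u \<partial>lborel)"
    by (rule nn_integral_unif01) measurable
  also have "\<dots> = (\<integral>\<^sup>+u. ennreal (indicator {0..r} u * u powr a) \<partial>lborel)"
    using r by (intro nn_integral_cong) (auto simp: indicator_def)
  also have "\<dots> = ennreal (r powr (a + 1) / (a + 1))"
    using a r by (intro nn_integral_has_integral_lebesgue has_integral_powr_from_0) auto
  finally show ?thesis .
qed

lemma nn_integral_unif01_powr:
  assumes a: "0 \<le> a"
  shows "(\<integral>\<^sup>+u. ennreal (u powr a) \<partial>unif01) = ennreal (1 / (a + 1))"
proof -
  have "(\<integral>\<^sup>+u. ennreal (u powr a) \<partial>unif01) = (\<integral>\<^sup>+u. ennreal (u powr a) * indicator {..1} u \<partial>unif01)"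
    by (rule nn_integral_cong_AE, rule eventually_mono[OF AE_unif01]) auto
  then show ?thesis using nn_integral_unif01_powr_atMost[OF a, of 1] by simp
qed

lemma probvec_le_1:
  assumes "probvec P" shows "P w \<le> 1"
proof -
  have "P w \<le> sum P UNIV"
    using assms by (intro member_le_sum) (auto simp: probvec_def)
  then show ?thesis using assms by (simp add: probvec_def)
qed

text \<open>Two distinct entries of a probability vector have sum at most 1. Paired with the mode
  \<open>m\<close>, any other entry is thus at most \<open>1 - P m\<close>, and at most 1/2 because
  it does not exceed \<open>P m\<close>.\<close>

lemma gap_obtain_max:
  fixes P :: "'w::finite \<Rightarrow> real"
  assumes P: "probvec P"
  obtains m where "P m = 1 - gap P" "\<And>w. P w \<le> P m" "\<And>w. w \<noteq> m \<Longrightarrow> P w \<le> gap P" "\<And>w. w \<noteq> m \<Longrightarrow> P w \<le> 1 / 2"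
    "0 < P m"
proof -
  have "Max (range P) \<in> range P" by (rule Max_in) auto
  then obtain m where m: "Max (range P) = P m" by (rule rangeE)
  have le: "P w \<le> P m" for w unfolding m[symmetric] by (rule Max_ge) auto
  have two: "P w + P m \<le> 1" if "w \<noteq> m" for w
  proof -
    have "P w + P m = sum P {w, m}" using that by simp
    also have "\<dots> \<le> sum P UNIV" using P by (intro sum_mono2) (auto simp: probvec_def)
    finally show ?thesis using P by (simp add: probvec_def)
  qed
  have "0 < P m"
  proof (rule ccontr)
    assume "\<not> 0 < P m"
    then have "sum P UNIV \<le> 0" using le by (intro sum_nonpos) (meson not_less order_trans)
    then show False using P by (simp add: probvec_def)
  qed
  then show ?thesis
  proof (rule that[rotated -1])
    show "P m = 1 - gap P" by (simp add: gap_def m)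
    show "P w \<le> P m" for w by (rule le)
    show "P w \<le> gap P" if "w \<noteq> m" for w using two[OF that] by (simp add: gap_def m)
    show "P w \<le> 1 / 2" if "w \<noteq> m" for w using two[OF that] le[of w] by simp
  qed
qed

lemma gap_bounds:
  fixes P :: "'w::finite \<Rightarrow> real"
  assumes "probvec P" shows "0 \<le> gap P" "gap P \<le> 1"
proof -
  obtain m where m: "P m = 1 - gap P" "0 < P m"
    using gap_obtain_max[OF assms] by metis
  then show "0 \<le> gap P" "gap P \<le> 1"
    using probvec_le_1[OF assms, of m] by auto
qed

text \<open>The double sum is the second moment of \<open>gumbel_dens P\<close> under
  \<open>unif01\<close>. As both \<open>1 / P v\<close> and \<open>1 / P w\<close> are at least 1,
  the summand is at most \<open>min (P v) (P w)\<close>: this is at most \<open>gap P\<close> unless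
  both tokens are the mode, and at most 1 for that single pair.\<close>

lemma gumbel_dens_square_sum_le:
  fixes P :: "'w::finite \<Rightarrow> real"
  assumes P: "probvec P"
  shows "(\<Sum>v | 0 < P v. \<Sum>w | 0 < P w. 1 / ((1 / P v - 1) + (1 / P w - 1) + 1)) \<le> 1 + (real CARD('w))\<^sup>2 * gap P"
proof -
  obtain m where m: "P m = 1 - gap P" "\<And>w. w \<noteq> m \<Longrightarrow> P w \<le> gap P" "0 < P m"
    using gap_obtain_max[OF P] by metis
  have le: "1 / ((1 / P v - 1) + (1 / P w - 1) + 1) \<le> gap P + (if v = m then if w = m then 1 else 0 else 0)"
    if vw: "0 < P v" "0 < P w" for v w
  proof -
    have ge: "1 \<le> 1 / P v" "1 \<le> 1 / P w"
      using vw probvec_le_1[OF P] by auto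
    have pos: "0 < (1 / P v - 1) + (1 / P w - 1) + 1"
      using ge by linarith
    have "1 / ((1 / P v - 1) + (1 / P w - 1) + 1) \<le> 1 / (1 / P v)"
      using ge vw pos by (intro divide_left_mono mult_pos_pos pos) auto
    then have v: "1 / ((1 / P v - 1) + (1 / P w - 1) + 1) \<le> P v" using vw by simp
    have "1 / ((1 / P v - 1) + (1 / P w - 1) + 1) \<le> 1 / (1 / P w)"
      using ge vw pos by (intro divide_left_mono mult_pos_pos pos) auto
    then have w: "1 / ((1 / P v - 1) + (1 / P w - 1) + 1) \<le> P w" using vw by simp
    show ?thesis
      using v w m(2)[of v] m(2)[of w] probvec_le_1[OF P, of v] gap_bounds(1)[OF P]
      by (cases "v = m"; cases "w = m"; simp; linarith)
  qed
  have "(\<Sum>v | 0 < P v. \<Sum>w | 0 < P w. 1 / ((1 / P v - 1) + (1 / P w - 1) + 1))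
    \<le> (\<Sum>v | 0 < P v. \<Sum>w | 0 < P w. gap P + (if v = m then if w = m then 1 else 0 else 0))"
    by (intro sum_mono le) auto
  also have "\<dots> \<le> (\<Sum>v\<in>UNIV. \<Sum>w\<in>UNIV. gap P + (if v = m then if w = m then 1 else 0 else 0))"
    using gap_bounds[OF P]
    by (intro order_trans[OF sum_mono sum_mono2] sum_mono2 sum_nonneg) auto
  also have "\<dots> = 1 + (real CARD('w))\<^sup>2 * gap P"
  proof -
    have "(\<Sum>w\<in>UNIV. if v = m then if w = m then 1 else 0 else 0) = (if v = m then 1 else 0 :: real)" for v
      by simp
    then show ?thesis by (simp add: sum.distrib power2_eq_square)
  qed
  finally show ?thesis .
qed

text \<open>Since \<open>gumbel_dens P\<close> has mean 1, expanding the square leaves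
  \<open>(1 - eps)\<^sup>2 + 2 * eps * (1 - eps) = 1 - eps\<^sup>2\<close> plus
  \<open>eps\<^sup>2\<close> times the second moment. The part linear in \<open>eps\<close> cancels,
  and the excess over 1 is of order \<open>eps\<^sup>2 * gap P\<close>.\<close>

lemma nn_integral_mix_dens_square_le:
  fixes P :: "'w::finite \<Rightarrow> real"
  assumes P: "probvec P" and eps: "0 \<le> eps" "eps \<le> 1"
  shows "(\<integral>\<^sup>+u. (ennreal (mix_dens eps P u))\<^sup>2 \<partial>unif01) \<le> ennreal (1 + eps\<^sup>2 * (real CARD('w))\<^sup>2 * gap P)"
proof -
  let ?S = "{w. 0 < P w}"
  let ?a = "\<lambda>w. 1 / P w - 1"
  have a: "0 \<le> ?a w" if "w \<in> ?S" for w
    using that probvec_le_1[OF P, of w] by simp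
  have S1: "(\<Sum>w\<in>?S. 1 / (?a w + 1)) = 1"
    using probvec_sum_support[OF P] by simp
  let ?d2 = "\<Sum>v\<in>?S. \<Sum>w\<in>?S. 1 / (?a v + ?a w + 1)"
  have sq: "(mix_dens eps P u)\<^sup>2 = (1 - eps)\<^sup>2 + (\<Sum>w\<in>?S. 2 * eps * (1 - eps) * u powr ?a w) +
      (\<Sum>v\<in>?S. \<Sum>w\<in>?S. eps\<^sup>2 * u powr (?a v + ?a w))" for u
  proof -
    have "(gumbel_dens P u)\<^sup>2 = (\<Sum>v\<in>?S. \<Sum>w\<in>?S. u powr (?a v + ?a w))"
      by (simp only: gumbel_dens_def power2_eq_square sum_product powr_add)
    then have "(\<Sum>v\<in>?S. \<Sum>w\<in>?S. eps\<^sup>2 * u powr (?a v + ?a w)) = eps\<^sup>2 * (gumbel_dens P u)\<^sup>2"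
      by (simp add: sum_distrib_left)
    moreover have "(\<Sum>w\<in>?S. 2 * eps * (1 - eps) * u powr ?a w) = 2 * eps * (1 - eps) * gumbel_dens P u"
      by (simp add: gumbel_dens_def sum_distrib_left)
    ultimately show ?thesis
      by (simp add: mix_dens_def power2_eq_square algebra_simps)
  qed
  have mix_nonneg: "0 \<le> mix_dens eps P u" for u
    using eps by (simp add: mix_dens_def gumbel_dens_nonneg)
  have "(\<integral>\<^sup>+u. (ennreal (mix_dens eps P u))\<^sup>2 \<partial>unif01) =
    (\<integral>\<^sup>+u. ennreal ((1 - eps)\<^sup>2) + (\<Sum>w\<in>?S. ennreal (2 * eps * (1 - eps)) * ennreal (u powr ?a w)) +
      (\<Sum>v\<in>?S. \<Sum>w\<in>?S. ennreal (eps\<^sup>2) * ennreal (u powr (?a v + ?a w))) \<partial>unif01)"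
  proof (rule nn_integral_cong)
    fix u
    show "(ennreal (mix_dens eps P u))\<^sup>2 = ennreal ((1 - eps)\<^sup>2) + (\<Sum>w\<in>?S. ennreal (2 * eps * (1 - eps)) * ennreal (u powr ?a w)) +
      (\<Sum>v\<in>?S. \<Sum>w\<in>?S. ennreal (eps\<^sup>2) * ennreal (u powr (?a v + ?a w)))"
      unfolding ennreal_power[OF mix_nonneg] sq using eps
      by (simp add: ennreal_plus sum_nonneg sum_ennreal flip: ennreal_mult)
  qed
  also have "\<dots> = ennreal ((1 - eps)\<^sup>2) + (\<Sum>w\<in>?S. ennreal (2 * eps * (1 - eps)) * (\<integral>\<^sup>+u. ennreal (u powr ?a w) \<partial>unif01)) +
      (\<Sum>v\<in>?S. \<Sum>w\<in>?S. ennreal (eps\<^sup>2) * (\<integral>\<^sup>+u. ennreal (u powr (?a v + ?a w)) \<partial>unif01))"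
    using prob_space.emeasure_space_1[OF prob_space_unif01]
    by (simp add: nn_integral_add nn_integral_sum nn_integral_cmult cong: measurable_cong_sets)
  also have "\<dots> = ennreal ((1 - eps)\<^sup>2) + (\<Sum>w\<in>?S. ennreal (2 * eps * (1 - eps)) * ennreal (1 / (?a w + 1))) +
      (\<Sum>v\<in>?S. \<Sum>w\<in>?S. ennreal (eps\<^sup>2) * ennreal (1 / (?a v + ?a w + 1)))"
    using a by (intro arg_cong2[where f = "(+)"] sum.cong refl arg_cong2[where f = "(*)"] nn_integral_unif01_powr)
      ((rule a add_nonneg_nonneg | assumption)+)
  also have "\<dots> = ennreal ((1 - eps)\<^sup>2) + ennreal (2 * eps * (1 - eps) * (\<Sum>w\<in>?S. 1 / (?a w + 1))) + ennreal (eps\<^sup>2 * ?d2)"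
  proof -
    have "(\<Sum>w\<in>?S. ennreal (2 * eps * (1 - eps)) * ennreal (1 / (?a w + 1))) =
        ennreal (2 * eps * (1 - eps) * (\<Sum>w\<in>?S. 1 / (?a w + 1)))"
      using eps a by (subst sum_distrib_left, subst sum_ennreal[symmetric]) (auto simp flip: ennreal_mult)
    moreover have "(\<Sum>v\<in>?S. \<Sum>w\<in>?S. ennreal (eps\<^sup>2) * ennreal (1 / (?a v + ?a w + 1))) = ennreal (eps\<^sup>2 * ?d2)"
    proof -
      have nn: "0 \<le> 1 / (?a v + ?a w + 1)" if "v \<in> ?S" "w \<in> ?S" for v w
        using a[OF that(1)] a[OF that(2)] by simp
      have "(\<Sum>v\<in>?S. \<Sum>w\<in>?S. ennreal (eps\<^sup>2) * ennreal (1 / (?a v + ?a w + 1))) =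
         (\<Sum>v\<in>?S. \<Sum>w\<in>?S. ennreal (eps\<^sup>2 * (1 / (?a v + ?a w + 1))))"
        using nn by (intro sum.cong refl ennreal_mult[symmetric]) auto
      also have "\<dots> = (\<Sum>v\<in>?S. ennreal (\<Sum>w\<in>?S. eps\<^sup>2 * (1 / (?a v + ?a w + 1))))"
        using nn by (intro sum.cong refl sum_ennreal mult_nonneg_nonneg) auto
      also have "\<dots> = ennreal (\<Sum>v\<in>?S. \<Sum>w\<in>?S. eps\<^sup>2 * (1 / (?a v + ?a w + 1)))"
        using nn by (intro sum_ennreal sum_nonneg mult_nonneg_nonneg) auto
      finally show ?thesis by (simp add: sum_distrib_left)
    qed
    ultimately show ?thesis by simp
  qed
  also have "\<dots> = ennreal (1 - eps\<^sup>2 + eps\<^sup>2 * ?d2)"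
  proof -
    have "0 \<le> ?d2" using a by (intro sum_nonneg divide_nonneg_nonneg add_nonneg_nonneg) auto
    then have "0 \<le> eps\<^sup>2 * ?d2" by simp
    then have "ennreal ((1 - eps)\<^sup>2) + ennreal (2 * eps * (1 - eps)) + ennreal (eps\<^sup>2 * ?d2) =
      ennreal ((1 - eps)\<^sup>2 + 2 * eps * (1 - eps) + eps\<^sup>2 * ?d2)"
      using eps by (simp only: ennreal_plus[symmetric] zero_le_power2 add_nonneg_nonneg mult_nonneg_nonneg diff_ge_0_iff_ge zero_le_numeral)
    also have "(1 - eps)\<^sup>2 + 2 * eps * (1 - eps) = 1 - eps\<^sup>2"
      by (simp add: power2_eq_square algebra_simps)
    finally show ?thesis unfolding S1 by simp
  qed
  also have "\<dots> \<le> ennreal (1 + eps\<^sup>2 * (real CARD('w))\<^sup>2 * gap P)"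
  proof (rule ennreal_leI)
    have "eps\<^sup>2 * ?d2 \<le> eps\<^sup>2 * (1 + (real CARD('w))\<^sup>2 * gap P)"
      by (intro mult_left_mono gumbel_dens_square_sum_le[OF P]) auto
    then show "1 - eps\<^sup>2 + eps\<^sup>2 * ?d2 \<le> 1 + eps\<^sup>2 * (real CARD('w))\<^sup>2 * gap P"
      by (simp add: algebra_simps)
  qed
  finally show ?thesis .
qed

section \<open>Cauchy-Schwarz iterated over time, and exponential moments\<close>

definition esqrt :: "ennreal \<Rightarrow> ennreal"
  where "esqrt x = (if x = \<top> then \<top> else ennreal (sqrt (enn2real x)))"

lemma measurable_esqrt [measurable]: "esqrt \<in> borel_measurable borel"
  unfolding esqrt_def[abs_def] by measurable

text \<open>Holds without exception because infinity is sent to itself; \<open>enn2real\<close>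
  alone would send it to 0.\<close>

lemma esqrt_power2 [simp]: "(esqrt x)\<^sup>2 = x"
  by (cases x) (auto simp: esqrt_def ennreal_power)

lemma le_esqrtI: "x\<^sup>2 \<le> y \<Longrightarrow> x \<le> esqrt y"
  by (cases x; cases y) (auto simp: esqrt_def ennreal_power top_unique intro: ennreal_leI real_le_rsqrt)

lemma measurable_Yspace_update_unif01:
  assumes "G \<in> borel_measurable (Yspace (Suc n))"
  shows "(\<lambda>(y, u). G (y(n := u))) \<in> borel_measurable (Yspace n \<Otimes>\<^sub>M unif01)"
proof -
  have "(\<lambda>(y, u). y(n := u)) \<in> measurable (Yspace n \<Otimes>\<^sub>M unif01) (Yspace (Suc n))"
    using measurable_Yspace_update[of n] by (simp cong: measurable_cong_sets)
  from measurable_compose[OF this assms] show ?thesis by (simp add: case_prod_beta')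
qed

lemma sets_H0law: "sets (H0law n) = sets (Yspace n)"
  unfolding H0law_def Yspace_def by (rule sets_PiM_cong) auto

lemma space_H0law: "space (H0law n) = space (Yspace n)"
  by (rule sets_eq_imp_space_eq[OF sets_H0law])

lemma prob_space_H0law: "prob_space (H0law n)"
  unfolding H0law_def by (rule prob_space_PiM) (rule prob_space_unif01)

lemma nn_integral_H0law_Suc:
  assumes G: "G \<in> borel_measurable (Yspace (Suc n))"
  shows "(\<integral>\<^sup>+y. G y \<partial>H0law (Suc n)) = (\<integral>\<^sup>+y. \<integral>\<^sup>+u. G (y(n := u)) \<partial>unif01 \<partial>H0law n)"
proof -
  have "G \<in> borel_measurable (H0law (Suc n))"
    using G sets_H0law measurable_cong_sets by blast
  then show ?thesis unfolding H0law_def lessThan_Suc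
    by (intro product_sigma_finite.product_nn_integral_insert[OF product_sigma_finite_unif01]) auto
qed

context gumbel_model
begin

text \<open>Induction over time for all \<open>G\<close> at once. Cauchy-Schwarz for the last
  observation bounds its conditional expectation by a square root, to which the induction hypothesis
  is applied; squaring removes the root, and Fubini under the product law \<open>H0law\<close>
  restores the integral of \<open>G\<close> squared. Each step costs one factor
  \<open>B\<close>.\<close>

lemma second_moment_bound:
  defines "B \<equiv> ennreal (1 + eps\<^sup>2 * (real CARD('w))\<^sup>2 * D)"
  shows "n \<le> N \<Longrightarrow> G \<in> borel_measurable (Yspace n) \<Longrightarrow>
    (\<integral>\<^sup>+y. G y \<partial>H1law eps K n)\<^sup>2 \<le> B ^ n * (\<integral>\<^sup>+y. (G y)\<^sup>2 \<partial>H0law n)"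
proof (induction n arbitrary: G)
  case 0
  \<comment> \<open>Without observations both laws are the point mass at
    \<open>\<lambda>_. undefined\<close>, the only point of the empty product.\<close>
  have "(\<integral>\<^sup>+y. G y \<partial>H1law eps K 0) = G (\<lambda>_. undefined)"
  proof -
    have "(\<lambda>h. G (Ymap 0 h)) \<in> borel_measurable histM"
      by (rule measurable_compose[OF measurable_Ymap 0(2)])
    then show ?thesis
      using nn_integral_H1law[OF 0(2)] by (simp add: nn_integral_return) (simp add: Ymap_def restrict_def)
  qed
  moreover have "(\<integral>\<^sup>+y. (G y)\<^sup>2 \<partial>H0law 0) = (G (\<lambda>_. undefined))\<^sup>2"
    unfolding H0law_def
    by (simp add: product_sigma_finite.nn_integral_empty[OF product_sigma_finite_unif01])
  ultimately show ?case by simp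
next
  case (Suc n)
  note G = Suc.prems(2)
  define I where "I y = (\<integral>\<^sup>+u. (G (y(n := u)))\<^sup>2 \<partial>unif01)" for y
  have G2: "(\<lambda>y. (G y)\<^sup>2) \<in> borel_measurable (Yspace (Suc n))"
    using G by measurable
  have I: "I \<in> borel_measurable (Yspace n)"
    unfolding I_def[abs_def]
    by (rule sigma_finite_measure.borel_measurable_nn_integral[OF _ measurable_Yspace_update_unif01[OF G2]])
      (rule prob_space_imp_sigma_finite[OF prob_space_unif01])
  \<comment> \<open>Depends on the past observations only, as the one-step bound requires; its
    square \<open>B * I y\<close> is again an integral over the last coordinate.\<close>
  define H where "H y = esqrt (B * I y)" for y
  have H: "H \<in> borel_measurable (Yspace n)"
    unfolding H_def[abs_def] by (rule measurable_compose[OF _ measurable_esqrt]) (use I in measurable)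
  have "(\<integral>\<^sup>+y. G y \<partial>H1law eps K (Suc n)) \<le> (\<integral>\<^sup>+y. H y \<partial>H1law eps K n)"
  proof (rule nn_integral_H1law_Suc_le[OF _ G H])
    fix y and P :: "'w \<Rightarrow> real" assume y: "y \<in> space (Yspace n)" and P: "probvec P" "gap P = D"
    have g: "(\<lambda>u. G (y(n := u))) \<in> borel_measurable unif01"
      using measurable_compose[OF measurable_Yspace_update1[OF y] G] measurable_cong_sets[OF sets_unif01 refl] by blast
    have "(\<integral>\<^sup>+u. G (y(n := u)) * ennreal (mix_dens eps P u) \<partial>unif01)\<^sup>2
      \<le> I y * (\<integral>\<^sup>+u. (ennreal (mix_dens eps P u))\<^sup>2 \<partial>unif01)"
      unfolding I_def by (rule Cauchy_Schwarz_nn_integral[OF g]) (simp cong: measurable_cong_sets)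
    also have "\<dots> \<le> I y * B"
      unfolding B_def using nn_integral_mix_dens_square_le[OF P(1) eps] P(2) by (intro mult_left_mono) auto
    finally show "(\<integral>\<^sup>+u. G (y(n := u)) * ennreal (mix_dens eps P u) \<partial>unif01) \<le> H y"
      unfolding H_def by (intro le_esqrtI) (simp add: mult.commute)
  qed (use Suc.prems in simp)
  then have "(\<integral>\<^sup>+y. G y \<partial>H1law eps K (Suc n))\<^sup>2 \<le> (\<integral>\<^sup>+y. H y \<partial>H1law eps K n)\<^sup>2"
    by (intro power_mono) auto
  also have "\<dots> \<le> B ^ n * (\<integral>\<^sup>+y. (H y)\<^sup>2 \<partial>H0law n)"
    by (rule Suc.IH[OF _ H]) (use Suc.prems in simp)
  also have "(\<integral>\<^sup>+y. (H y)\<^sup>2 \<partial>H0law n) = B * (\<integral>\<^sup>+y. I y \<partial>H0law n)"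
    using I sets_H0law by (simp add: H_def nn_integral_cmult cong: measurable_cong_sets)
  also have "(\<integral>\<^sup>+y. I y \<partial>H0law n) = (\<integral>\<^sup>+y. (G y)\<^sup>2 \<partial>H0law (Suc n))"
    unfolding I_def by (rule nn_integral_H0law_Suc[OF G2, symmetric])
  finally show ?case by (simp add: mult_ac)
qed

text \<open>Takes the place of independence under the alternative: each conditional factor is at
  most \<open>b\<close> whatever the history, so the factors can be peeled off from the last one
  backwards.\<close>

lemma product_bound:
  assumes f[measurable]: "f \<in> borel_measurable borel"
    and b: "\<And>P :: 'w \<Rightarrow> real. probvec P \<Longrightarrow> gap P = D \<Longrightarrow> (\<integral>\<^sup>+u. f u * ennreal (mix_dens eps P u) \<partial>unif01) \<le> b"
  shows "n \<le> N \<Longrightarrow> (\<integral>\<^sup>+y. (\<Prod>t<n. f (y t)) \<partial>H1law eps K n) \<le> b ^ n"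
proof (induction n)
  case 0
  interpret prob_space "H1law eps K 0" by (rule prob_space_H1law) simp
  show ?case by (simp add: emeasure_space_1)
next
  case (Suc n)
  have m: "(\<lambda>y. \<Prod>t<k. f (y t)) \<in> borel_measurable (Yspace k)" for k
    unfolding Yspace_def
    by (intro borel_measurable_prod_ennreal measurable_compose[OF _ f]) (rule measurable_component_singleton)
  have "(\<integral>\<^sup>+y. (\<Prod>t<Suc n. f (y t)) \<partial>H1law eps K (Suc n)) \<le> (\<integral>\<^sup>+y. b * (\<Prod>t<n. f (y t)) \<partial>H1law eps K n)"
  proof (rule nn_integral_H1law_Suc_le[OF _ m])
    fix y and P :: "'w \<Rightarrow> real" assume y: "y \<in> space (Yspace n)" and P: "probvec P" "gap P = D"
    have "(\<Prod>t<Suc n. f ((y(n := u)) t)) * ennreal (mix_dens eps P u) =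
        (\<Prod>t<n. f (y t)) * (f u * ennreal (mix_dens eps P u))" for u
      by (simp add: mult_ac)
    then have "(\<integral>\<^sup>+u. (\<Prod>t<Suc n. f ((y(n := u)) t)) * ennreal (mix_dens eps P u) \<partial>unif01) =
       (\<Prod>t<n. f (y t)) * (\<integral>\<^sup>+u. f u * ennreal (mix_dens eps P u) \<partial>unif01)"
      by (simp only:) (rule nn_integral_cmult, simp cong: measurable_cong_sets)
    also have "\<dots> \<le> (\<Prod>t<n. f (y t)) * b"
      by (intro mult_left_mono b P) simp
    finally show "(\<integral>\<^sup>+u. (\<Prod>t<Suc n. f ((y(n := u)) t)) * ennreal (mix_dens eps P u) \<partial>unif01) \<le> b * (\<Prod>t<n. f (y t))"
      by (simp add: mult.commute)
  qed (use Suc.prems m in auto)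
  also have "\<dots> = b * (\<integral>\<^sup>+y. (\<Prod>t<n. f (y t)) \<partial>H1law eps K n)"
    by (rule nn_integral_cmult) (use m sets_H1law measurable_cong_sets in blast)
  also have "\<dots> \<le> b * b ^ n"
    by (rule mult_left_mono) (use Suc in auto)
  finally show ?case by simp
qed

end

lemma nn_integral_H0law_prod:
  assumes f[measurable]: "f \<in> borel_measurable borel"
  shows "(\<integral>\<^sup>+y. (\<Prod>t<n. f (y t)) \<partial>H0law n) = (\<integral>\<^sup>+u. f u \<partial>unif01) ^ n"
  unfolding H0law_def
  by (subst product_sigma_finite.product_nn_integral_prod[OF product_sigma_finite_unif01, where f = "\<lambda>_. f"])
    (auto cong: measurable_cong_sets)

section \<open>Comparison of the two laws on events\<close>

context gumbel_model
begin

text \<open>An almost sure property of the probability measure \<open>K 0 h\<close> holds for some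
  vector, whose gap is \<open>D\<close>. For \<open>N = 0\<close> the kernels are
  unconstrained.\<close>

lemma D_bounds:
  assumes "0 < N" shows "0 \<le> D" "D \<le> 1"
proof -
  interpret prob_space "K 0 h" for h by (rule prob_space_K)
  have "\<exists>P::'w \<Rightarrow> real. probvec P \<and> gap P = D"
    using eventually_happens'[OF _ K_probvec[OF assms]] by (metis ae_filter_bot)
  then show "0 \<le> D" "D \<le> 1" using gap_bounds by blast+
qed

text \<open>For \<open>G = 1 + s * indicator A\<close>, \<open>second_moment_bound\<close> compares
  \<open>(1 + s * ?a1)\<^sup>2\<close> with
  \<open>(1 + s\<^sup>2) * (1 + (2 * s + s\<^sup>2) * ?a0)\<close>. The terms of first order in
  \<open>s\<close> are \<open>2 * s * ?a1\<close> and \<open>2 * s * ?a0\<close>; all others are of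
  order \<open>s\<^sup>2\<close>, so division by \<open>2 * s\<close> leaves an error of order
  \<open>s\<close>.\<close>

lemma measure_diff_le:
  assumes A: "A \<in> sets (Yspace N)" and s: "0 < s"
    and B: "(1 + eps\<^sup>2 * (real CARD('w))\<^sup>2 * D) ^ N \<le> 1 + s\<^sup>2" and D: "0 \<le> D"
  shows "measure (H1law eps K N) A - measure (H0law N) A \<le> s + s\<^sup>2 + s ^ 3 / 2"
proof -
  interpret H1: prob_space "H1law eps K N" by (rule prob_space_H1law) simp
  interpret H0: prob_space "H0law N" by (rule prob_space_H0law)
  let ?G = "\<lambda>y. ennreal 1 + ennreal s * indicator A y"
  let ?a1 = "measure (H1law eps K N) A" and ?a0 = "measure (H0law N) A"
  let ?B = "1 + eps\<^sup>2 * (real CARD('w))\<^sup>2 * D"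
  have A1: "A \<in> sets (H1law eps K N)" and A0: "A \<in> sets (H0law N)"
    using A by (simp_all add: sets_H1law sets_H0law)
  have G: "?G \<in> borel_measurable (Yspace N)" using A by measurable
  have e1: "(\<integral>\<^sup>+y. ?G y \<partial>H1law eps K N) = ennreal (1 + s * ?a1)"
  proof -
    have "(\<integral>\<^sup>+y. ?G y \<partial>H1law eps K N) = ennreal 1 + ennreal s * emeasure (H1law eps K N) A"
      using A1 by (simp add: nn_integral_add nn_integral_cmult H1.emeasure_space_1)
    also have "\<dots> = ennreal (1 + s * ?a1)"
      using s by (simp add: H1.emeasure_eq_measure ennreal_mult ennreal_plus del: ennreal_1)
    finally show ?thesis .
  qed
  have G2: "(?G y)\<^sup>2 = ennreal 1 + ennreal (2 * s + s\<^sup>2) * indicator A y" for y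
  proof (cases "y \<in> A")
    case True
    have "(ennreal 1 + ennreal s)\<^sup>2 = ennreal ((1 + s)\<^sup>2)"
      using s by (simp add: ennreal_power del: ennreal_1 flip: ennreal_plus)
    also have "(1 + s)\<^sup>2 = 1 + (2 * s + s\<^sup>2)"
      by (simp add: power2_eq_square algebra_simps)
    also have "ennreal (1 + (2 * s + s\<^sup>2)) = ennreal 1 + ennreal (2 * s + s\<^sup>2)"
      using s by (intro ennreal_plus) auto
    finally show ?thesis using True by simp
  qed simp
  have e0: "(\<integral>\<^sup>+y. (?G y)\<^sup>2 \<partial>H0law N) = ennreal (1 + (2 * s + s\<^sup>2) * ?a0)"
  proof -
    have "(\<integral>\<^sup>+y. (?G y)\<^sup>2 \<partial>H0law N) = ennreal 1 + ennreal (2 * s + s\<^sup>2) * emeasure (H0law N) A"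
      unfolding G2 using A0 by (simp add: nn_integral_add nn_integral_cmult H0.emeasure_space_1)
    also have "\<dots> = ennreal (1 + (2 * s + s\<^sup>2) * ?a0)"
      using s by (simp add: H0.emeasure_eq_measure ennreal_mult ennreal_plus del: ennreal_1)
    finally show ?thesis .
  qed
  have "ennreal ((1 + s * ?a1)\<^sup>2) \<le> ennreal (?B ^ N * (1 + (2 * s + s\<^sup>2) * ?a0))"
  proof -
    have "ennreal ((1 + s * ?a1)\<^sup>2) = (ennreal (1 + s * ?a1))\<^sup>2"
      using s by (intro ennreal_power[symmetric]) simp
    also have "\<dots> \<le> ennreal ?B ^ N * ennreal (1 + (2 * s + s\<^sup>2) * ?a0)"
      using second_moment_bound[OF order_refl G] unfolding e1 e0 .
    also have "\<dots> = ennreal (?B ^ N * (1 + (2 * s + s\<^sup>2) * ?a0))"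
      using s D by (simp add: ennreal_power ennreal_mult del: ennreal_plus)
    finally show ?thesis .
  qed
  then have "(1 + s * ?a1)\<^sup>2 \<le> ?B ^ N * (1 + (2 * s + s\<^sup>2) * ?a0)"
    using s D by (subst (asm) ennreal_le_iff) auto
  also have "\<dots> \<le> (1 + s\<^sup>2) * (1 + (2 * s + s\<^sup>2) * ?a0)"
    using s by (intro mult_right_mono B) auto
  also have "\<dots> = 1 + s\<^sup>2 + 2 * s * ?a0 + (s\<^sup>2 + s\<^sup>2 * (2 * s + s\<^sup>2)) * ?a0"
    by (simp add: algebra_simps power2_eq_square)
  also have "\<dots> \<le> 1 + s\<^sup>2 + 2 * s * ?a0 + (s\<^sup>2 + s\<^sup>2 * (2 * s + s\<^sup>2)) * 1"
    using s by (intro add_left_mono mult_left_mono) auto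
  also have "\<dots> = 1 + 2 * s * ?a0 + 2 * s * (s + s\<^sup>2 + s ^ 3 / 2)"
    by (simp add: algebra_simps power2_eq_square power3_eq_cube)
  finally have "1 + 2 * s * ?a1 + (s * ?a1)\<^sup>2 \<le> 1 + 2 * s * ?a0 + 2 * s * (s + s\<^sup>2 + s ^ 3 / 2)"
    by (simp add: power2_sum algebra_simps)
  then have "(2 * s) * ?a1 \<le> (2 * s) * (?a0 + (s + s\<^sup>2 + s ^ 3 / 2))"
    using zero_le_power2[of "s * ?a1"] by (simp only: distrib_left)
  then have "?a1 \<le> ?a0 + (s + s\<^sup>2 + s ^ 3 / 2)"
    using s by simp
  then show ?thesis by simp
qed

text \<open>The one-sided bound, applied to the complement of \<open>A\<close> as well, gives the
  opposite sign.\<close>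

lemma abs_measure_diff_le:
  assumes A: "A \<in> sets (Yspace N)" and s: "0 < s"
    and B: "(1 + eps\<^sup>2 * (real CARD('w))\<^sup>2 * D) ^ N \<le> 1 + s\<^sup>2" and D: "0 \<le> D"
  shows "\<bar>measure (H0law N) A - measure (H1law eps K N) A\<bar> \<le> s + s\<^sup>2 + s ^ 3 / 2"
proof -
  interpret H1: prob_space "H1law eps K N" by (rule prob_space_H1law) simp
  interpret H0: prob_space "H0law N" by (rule prob_space_H0law)
  have sp1: "space (H1law eps K N) = space (Yspace N)"
    by (rule sets_eq_imp_space_eq[OF sets_H1law])
  have "measure (H1law eps K N) (space (Yspace N) - A) - measure (H0law N) (space (Yspace N) - A) \<le> s + s\<^sup>2 + s ^ 3 / 2"
    using A by (intro measure_diff_le[OF _ s B D]) auto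
  moreover have "measure (H1law eps K N) (space (Yspace N) - A) = 1 - measure (H1law eps K N) A"
    using H1.prob_compl[of A] A sp1 by (simp add: sets_H1law)
  moreover have "measure (H0law N) (space (Yspace N) - A) = 1 - measure (H0law N) A"
    using H0.prob_compl[of A] A space_H0law[of N] by (simp add: sets_H0law)
  ultimately show ?thesis
    using measure_diff_le[OF A s B D] by linarith
qed

text \<open>An indicator equals its square, so \<open>second_moment_bound\<close> carries null sets
  of \<open>H0law\<close> over to \<open>H1law\<close>.\<close>

lemma absolutely_continuous_H1law: "absolutely_continuous (H0law N) (H1law eps K N)"
  unfolding absolutely_continuous_def
proof
  fix A assume A: "A \<in> null_sets (H0law N)"
  then have A': "A \<in> sets (Yspace N)" by (auto simp: sets_H0law)
  have "(\<integral>\<^sup>+y. indicator A y \<partial>H1law eps K N)\<^sup>2 \<le>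
    ennreal (1 + eps\<^sup>2 * (real CARD('w))\<^sup>2 * D) ^ N * (\<integral>\<^sup>+y. (indicator A y)\<^sup>2 \<partial>H0law N)"
    using A' by (intro second_moment_bound) auto
  also have "(\<lambda>y. (indicator A y :: ennreal)\<^sup>2) = indicator A"
    by (auto simp: indicator_def)
  also have "(\<integral>\<^sup>+y. indicator A y \<partial>H0law N) = 0"
    using A by (subst nn_integral_indicator) auto
  finally have "(emeasure (H1law eps K N) A)\<^sup>2 = 0"
    using A' by (simp add: sets_H1law)
  then show "A \<in> null_sets (H1law eps K N)"
    using A' by (auto simp: null_sets_def sets_H1law)
qed

end

section \<open>Total variation and the likelihood-ratio test\<close>

text \<open>The supremum in \<open>tvdist\<close> is a real one and dominates its members only once
  they are known to be bounded.\<close>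

lemma bdd_above_measure_diff:
  assumes M: "prob_space M" and M': "prob_space M'" and sets: "sets M' = sets M"
  shows "bdd_above ((\<lambda>A. \<bar>measure M A - measure M' A\<bar>) ` sets M)"
proof -
  interpret M: prob_space M by fact
  interpret M': prob_space M' by fact
  show ?thesis
    by (rule bdd_aboveI2[where M = 1]) (smt (verit) M.prob_le_1 M'.prob_le_1 measure_nonneg)
qed

lemma tvdist_ge:
  assumes "prob_space M" "prob_space M'" "sets M' = sets M" "A \<in> sets M"
  shows "\<bar>measure M A - measure M' A\<bar> \<le> tvdist M M'"
  unfolding tvdist_def by (rule cSUP_upper[OF assms(4) bdd_above_measure_diff[OF assms(1-3)]])

lemma tvdist_le:
  assumes "\<And>A. A \<in> sets M \<Longrightarrow> \<bar>measure M A - measure M' A\<bar> \<le> d"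
  shows "tvdist M M' \<le> d"
  unfolding tvdist_def by (rule cSUP_least) (use assms in auto)

section \<open>Domination by Lebesgue measure and optimality of the likelihood-ratio test\<close>

lemma sets_lebM: "sets (lebM n) = sets (Yspace n)"
  unfolding lebM_def Yspace_def by (rule sets_PiM_cong) auto

text \<open>\<open>unif01\<close> is Lebesgue measure restricted to the unit interval, so the
  comparison holds in each coordinate. It yields the absolute continuity that gives the densities in
  \<open>LR_reject\<close> their meaning.\<close>

lemma nn_integral_H0law_le_lebM:
  "G \<in> borel_measurable (Yspace n) \<Longrightarrow> (\<integral>\<^sup>+y. G y \<partial>H0law n) \<le> (\<integral>\<^sup>+y. G y \<partial>lebM n)"
proof (induction n arbitrary: G)
  case 0
  have "product_sigma_finite (\<lambda>_::nat. lborel :: real measure)" ..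
  then show ?case
    unfolding H0law_def lebM_def
    by (simp add: product_sigma_finite.nn_integral_empty product_sigma_finite_unif01)
next
  case (Suc n)
  interpret L: product_sigma_finite "\<lambda>_::nat. lborel :: real measure" ..
  have le: "(\<integral>\<^sup>+u. g u \<partial>unif01) \<le> (\<integral>\<^sup>+u. g u \<partial>lborel)" if "g \<in> borel_measurable borel" for g
    unfolding nn_integral_unif01[OF that] by (rule nn_integral_mono) (auto simp: indicator_def)
  have m: "(\<lambda>y. \<integral>\<^sup>+u. G (y(n := u)) \<partial>unif01) \<in> borel_measurable (Yspace n)"
    by (rule sigma_finite_measure.borel_measurable_nn_integral[OF _ measurable_Yspace_update_unif01[OF Suc.prems]])
      (rule prob_space_imp_sigma_finite[OF prob_space_unif01])
  have "(\<integral>\<^sup>+y. G y \<partial>H0law (Suc n)) = (\<integral>\<^sup>+y. \<integral>\<^sup>+u. G (y(n := u)) \<partial>unif01 \<partial>H0law n)"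
    by (rule nn_integral_H0law_Suc[OF Suc.prems])
  also have "\<dots> \<le> (\<integral>\<^sup>+y. \<integral>\<^sup>+u. G (y(n := u)) \<partial>unif01 \<partial>lebM n)"
    by (rule Suc.IH[OF m])
  also have "\<dots> \<le> (\<integral>\<^sup>+y. \<integral>\<^sup>+u. G (y(n := u)) \<partial>lborel \<partial>lebM n)"
    by (intro nn_integral_mono le measurable_compose[OF measurable_Yspace_update1 Suc.prems])
      (simp add: sets_eq_imp_space_eq[OF sets_lebM])
  also have "\<dots> = (\<integral>\<^sup>+y. G y \<partial>lebM (Suc n))"
  proof -
    have "G \<in> borel_measurable (lebM (Suc n))"
      using Suc.prems sets_lebM measurable_cong_sets by blast
    then show ?thesis unfolding lebM_def lessThan_Suc
      by (intro L.product_nn_integral_insert[symmetric]) auto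
  qed
  finally show ?case .
qed

lemma absolutely_continuous_H0law: "absolutely_continuous (lebM n) (H0law n)"
  unfolding absolutely_continuous_def
proof
  fix A assume A: "A \<in> null_sets (lebM n)"
  then have A': "A \<in> sets (Yspace n)" by (auto simp: sets_lebM)
  have "(\<integral>\<^sup>+y. indicator A y \<partial>H0law n) \<le> (\<integral>\<^sup>+y. indicator A y \<partial>lebM n)"
    using A' by (intro nn_integral_H0law_le_lebM) auto
  then have "emeasure (H0law n) A \<le> emeasure (lebM n) A"
    using A' by (simp add: sets_lebM sets_H0law)
  then show "A \<in> null_sets (H0law n)"
    using A A' by (auto simp: null_sets_def sets_H0law)
qed

lemma sigma_finite_lebM: "sigma_finite_measure (lebM n)"
proof -
  interpret finite_product_sigma_finite "\<lambda>_::nat. lborel :: real measure" "{..<n}" by standard auto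
  show ?thesis unfolding lebM_def by (rule sigma_finite_measure_axioms)
qed

text \<open>Written as integrals over \<open>L\<close>, the two errors of a test pay the density of
  \<open>M0\<close> where it rejects and that of \<open>M1\<close> where it accepts. Almost
  everywhere \<open>R\<close> pays the smaller of the two.\<close>

lemma likelihood_ratio_test_optimal:
  fixes L M0 M1 :: "'a measure"
  defines "R \<equiv> {y \<in> space L. ln (enn2real (RN_deriv L M1 y) / enn2real (RN_deriv L M0 y)) > 0}"
  assumes L: "sigma_finite_measure L" and M0: "prob_space M0" "sets M0 = sets L" "absolutely_continuous L M0"
    and M1: "prob_space M1" "sets M1 = sets L" and ac: "absolutely_continuous M0 M1"
    and A: "A \<in> sets L"
  shows "measure M0 R + measure M1 (space L - R) \<le> measure M0 A + measure M1 (space L - A)"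
proof -
  interpret L: sigma_finite_measure L by fact
  interpret M0: prob_space M0 by fact
  interpret M1: prob_space M1 by fact
  have acL: "absolutely_continuous L M1"
    using ac M0(3) unfolding absolutely_continuous_def by blast
  let ?f0 = "RN_deriv L M0" and ?f1 = "RN_deriv L M1"
  have [measurable]: "A \<in> sets L" "R \<in> sets L"
    using A by (auto simp: R_def)
  have e0: "emeasure M0 S = (\<integral>\<^sup>+y. ?f0 y * indicator S y \<partial>L)" if "S \<in> sets L" for S
    using emeasure_density[of ?f0 L S] that L.density_RN_deriv[OF M0(3,2)] by simp
  have e1: "emeasure M1 S = (\<integral>\<^sup>+y. ?f1 y * indicator S y \<partial>L)" if "S \<in> sets L" for S
    using emeasure_density[of ?f1 L S] that L.density_RN_deriv[OF acL M1(2)] by simp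
  have fin: "AE y in L. ?f0 y \<noteq> \<infinity>" "AE y in L. ?f1 y \<noteq> \<infinity>"
    using L.RN_deriv_finite[OF M0.sigma_finite_measure_axioms M0(3,2)]
      L.RN_deriv_finite[OF M1.sigma_finite_measure_axioms acL M1(2)] by auto
  \<comment> \<open>Where the density of \<open>M0\<close> vanishes the quotient is 0 by convention
    and the test accepts, which would be wrong if the density of \<open>M1\<close> were positive
    there. \<open>M0\<close> gives this set mass 0, hence so does \<open>M1\<close>, and its density
    is 0 there almost everywhere.\<close>
  let ?Z = "{y \<in> space L. ?f0 y = 0}"
  have Z: "?Z \<in> sets L" by measurable
  have "emeasure M0 ?Z = 0"
    unfolding e0[OF Z] by (subst nn_integral_0_iff_AE) (auto simp: indicator_def)
  then have "?Z \<in> null_sets M0"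
    using Z M0(2) by (simp add: null_sets_def)
  then have "?Z \<in> null_sets M1"
    using ac unfolding absolutely_continuous_def by blast
  then have "emeasure M1 ?Z = 0" by (rule null_setsD1)
  then have zero: "AE y in L. y \<in> ?Z \<longrightarrow> ?f1 y = 0"
    unfolding e1[OF Z] by (subst (asm) nn_integral_0_iff_AE) (auto simp: indicator_def elim!: eventually_mono)
  have "emeasure M0 R + emeasure M1 (space L - R) =
     (\<integral>\<^sup>+y. ?f0 y * indicator R y + ?f1 y * indicator (space L - R) y \<partial>L)"
    by (subst nn_integral_add) (auto simp: e0 e1)
  also have "\<dots> \<le> (\<integral>\<^sup>+y. ?f0 y * indicator A y + ?f1 y * indicator (space L - A) y \<partial>L)"
  proof (rule nn_integral_mono_AE)
    show "AE y in L. ?f0 y * indicator R y + ?f1 y * indicator (space L - R) y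
      \<le> ?f0 y * indicator A y + ?f1 y * indicator (space L - A) y"
      using fin zero AE_space
    proof eventually_elim
      case (elim y)
      obtain a where a: "?f0 y = ennreal a" "0 \<le> a" using elim(1) by (cases "?f0 y") auto
      obtain b where b: "?f1 y = ennreal b" "0 \<le> b" using elim(2) by (cases "?f1 y") auto
      have b0: "a = 0 \<Longrightarrow> b = 0" using elim(3,4) a b by auto
      have "y \<in> R \<longleftrightarrow> 0 < ln (b / a)" using elim(4) a b by (simp add: R_def)
      also have "\<dots> \<longleftrightarrow> a < b"
      proof (cases "a = 0 \<or> b = 0")
        case True
        \<comment> \<open>junk values: \<open>b / 0 = 0\<close> and \<open>ln 0 = 0\<close>, so the test does not reject here\<close>
        then show ?thesis using b0 a b by auto
      next
        case False
        then show ?thesis using a b by (simp add: ln_gt_zero_iff)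
      qed
      finally show ?case
        using a b elim(4) by (auto simp: indicator_def intro!: ennreal_leI)
    qed
  qed
  also have "\<dots> = emeasure M0 A + emeasure M1 (space L - A)"
    by (subst nn_integral_add) (auto simp: e0 e1)
  finally show ?thesis
    by (simp add: M0.emeasure_eq_measure M1.emeasure_eq_measure flip: ennreal_plus)
qed

lemma (in gumbel_model) LR_test_optimal:
  assumes A: "A \<in> sets (Yspace N)"
  shows "measure (H0law N) (LR_reject eps K N) + measure (H1law eps K N) (space (Yspace N) - LR_reject eps K N)
    \<le> measure (H0law N) A + measure (H1law eps K N) (space (Yspace N) - A)"
  using likelihood_ratio_test_optimal[OF sigma_finite_lebM prob_space_H0law _ absolutely_continuous_H0law
      prob_space_H1law[OF order_refl] _ absolutely_continuous_H1law, of A] A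
  by (simp add: sets_lebM sets_H0law sets_H1law LR_reject_def sets_eq_imp_space_eq[OF sets_lebM])

lemma (in gumbel_model) sets_LR_reject: "LR_reject eps K N \<in> sets (Yspace N)"
proof -
  have "LR_reject eps K N \<in> sets (lebM N)"
    unfolding LR_reject_def sets_eq_imp_space_eq[OF sets_lebM, symmetric] by measurable
  then show ?thesis by (simp add: sets_lebM)
qed

section \<open>A counting test\<close>

lemma nn_integral_mix_dens_atMost:
  fixes P :: "'w::finite \<Rightarrow> real"
  assumes P: "probvec P" and eps: "0 \<le> eps" "eps \<le> 1" and r: "0 \<le> r" "r \<le> 1"
  shows "(\<integral>\<^sup>+u. indicator {..r} u * ennreal (mix_dens eps P u) \<partial>unif01) =
    ennreal ((1 - eps) * r + eps * (\<Sum>w | 0 < P w. P w * r powr (1 / P w)))"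
proof -
  let ?S = "{w. 0 < P w}"
  have a: "0 \<le> 1 / P w - 1" if "w \<in> ?S" for w
    using that probvec_le_1[OF P, of w] by simp
  have mix: "ennreal (mix_dens eps P u) = ennreal (1 - eps) + (\<Sum>w\<in>?S. ennreal eps * ennreal (u powr (1 / P w - 1)))" for u
  proof -
    have "mix_dens eps P u = (1 - eps) + (\<Sum>w\<in>?S. eps * u powr (1 / P w - 1))"
      by (simp add: mix_dens_def gumbel_dens_def sum_distrib_left)
    then show ?thesis
      using eps by (simp add: ennreal_plus sum_nonneg sum_ennreal flip: ennreal_mult)
  qed
  have "(\<integral>\<^sup>+u. indicator {..r} u * ennreal (mix_dens eps P u) \<partial>unif01) =
    (\<integral>\<^sup>+u. ennreal (1 - eps) * indicator {..r} u +
      (\<Sum>w\<in>?S. ennreal eps * (ennreal (u powr (1 / P w - 1)) * indicator {..r} u)) \<partial>unif01)"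
    unfolding mix by (intro nn_integral_cong) (simp add: distrib_left sum_distrib_left mult_ac)
  also have "\<dots> = ennreal (1 - eps) * emeasure unif01 {..r} +
      (\<Sum>w\<in>?S. ennreal eps * (\<integral>\<^sup>+u. ennreal (u powr (1 / P w - 1)) * indicator {..r} u \<partial>unif01))"
    by (simp add: nn_integral_add nn_integral_sum nn_integral_cmult cong: measurable_cong_sets)
  also have "\<dots> = ennreal (1 - eps) * ennreal r + (\<Sum>w\<in>?S. ennreal eps * ennreal (P w * r powr (1 / P w)))"
  proof -
    have "(\<integral>\<^sup>+u. ennreal (u powr (1 / P w - 1)) * indicator {..r} u \<partial>unif01) = ennreal (P w * r powr (1 / P w))"
      if "w \<in> ?S" for w
      using nn_integral_unif01_powr_atMost[OF a[OF that] r] by (simp add: mult.commute)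
    then show ?thesis by (simp add: emeasure_unif01_atMost[OF r])
  qed
  also have "\<dots> = ennreal ((1 - eps) * r + eps * (\<Sum>w\<in>?S. P w * r powr (1 / P w)))"
  proof -
    have "(\<Sum>w\<in>?S. ennreal eps * ennreal (P w * r powr (1 / P w))) = ennreal (eps * (\<Sum>w\<in>?S. P w * r powr (1 / P w)))"
    proof -
      have nn: "0 \<le> (\<Sum>w\<in>?S. P w * r powr (1 / P w))" by (intro sum_nonneg) auto
      have "(\<Sum>w\<in>?S. ennreal (P w * r powr (1 / P w))) = ennreal (\<Sum>w\<in>?S. P w * r powr (1 / P w))"
        by (rule sum_ennreal) auto
      then show ?thesis
        using ennreal_mult[OF eps(1) nn] by (simp flip: sum_distrib_left)
    qed
    moreover have "0 \<le> eps * (\<Sum>w\<in>?S. P w * r powr (1 / P w))"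
      using eps by (intro mult_nonneg_nonneg sum_nonneg) auto
    ultimately show ?thesis using eps r by (simp add: ennreal_mult ennreal_plus)
  qed
  finally show ?thesis .
qed

lemma nn_integral_mix_dens:
  fixes P :: "'w::finite \<Rightarrow> real"
  assumes P: "probvec P" and eps: "0 \<le> eps" "eps \<le> 1"
  shows "(\<integral>\<^sup>+u. ennreal (mix_dens eps P u) \<partial>unif01) = 1"
proof -
  have "(\<integral>\<^sup>+u. ennreal (mix_dens eps P u) \<partial>unif01) = (\<integral>\<^sup>+u. indicator {..1} u * ennreal (mix_dens eps P u) \<partial>unif01)"
    by (rule nn_integral_cong_AE, rule eventually_mono[OF AE_unif01]) auto
  also have "\<dots> = 1"
    by (simp add: nn_integral_mix_dens_atMost[OF P eps] probvec_sum_support[OF P])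
  finally show ?thesis .
qed

text \<open>The tokens other than the mode carry total mass \<open>gap P\<close>. For each of them
  \<open>r powr (1 / P w - 1)\<close> is at most 4/5, a loss of at least
  \<open>r / 5 \<ge> 1 / 10\<close> per unit of mass compared with the uniform CDF
  \<open>r\<close>.\<close>

lemma gumbel_cdf_le:
  fixes P :: "'w::finite \<Rightarrow> real"
  assumes P: "probvec P"
  defines "r \<equiv> 1 - gap P / 2"
  shows "(\<Sum>w | 0 < P w. P w * r powr (1 / P w)) \<le> r - gap P / 10"
proof -
  obtain m where m: "P m = 1 - gap P" "0 < P m"
    and other: "\<And>w. w \<noteq> m \<Longrightarrow> P w \<le> gap P" "\<And>w. w \<noteq> m \<Longrightarrow> P w \<le> 1 / 2"
    using gap_obtain_max[OF P] by metis
  have r: "1 / 2 \<le> r" "r \<le> 1" using gap_bounds[OF P] by (auto simp: r_def)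
  have r_exp: "r \<le> exp (- (gap P / 2))"
    unfolding r_def using exp_ge_add_one_self[of "- (gap P / 2)"] by simp
  \<comment> \<open>The reciprocal form of \<open>exp (1 / 4) \<ge> 5 / 4\<close>.\<close>
  have exp45: "exp (- (1 / 4)) \<le> (4 / 5 :: real)"
    using exp_ge_add_one_self[of "1 / 4 :: real"] by (simp add: exp_minus field_simps)
  have split: "r powr (1 / P w) = r * r powr (1 / P w - 1)" if "0 < P w" for w
    using r powr_add[of r 1 "1 / P w - 1"] by simp
  have term_m: "P w * r powr (1 / P w) \<le> P w * r" if "0 < P w" for w
  proof -
    have "0 \<le> 1 / P w - 1" using that probvec_le_1[OF P, of w] by simp
    then have "r powr (1 / P w - 1) \<le> 1"
      using r powr_mono2[of "1 / P w - 1" r 1] by simp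
    then have "r * r powr (1 / P w - 1) \<le> r * 1" using r by (intro mult_left_mono) auto
    then show ?thesis using that unfolding split[OF that] by (intro mult_left_mono) auto
  qed
  have term_other: "P w * r powr (1 / P w) \<le> P w * (4 / 5 * r)" if "0 < P w" "w \<noteq> m" for w
  proof -
    \<comment> \<open>\<open>P w \<le> 1 / 2\<close> allows the exponent
      \<open>1 / (2 * P w)\<close>. Then \<open>r \<le> exp (- (gap P / 2))\<close> and
      \<open>P w \<le> gap P\<close> bring the power down to \<open>exp (- (1 / 4))\<close>.\<close>
    have "1 / (2 * P w) \<le> 1 / P w - 1"
      using that other(2)[OF that(2)] by (simp add: field_simps)
    then have "r powr (1 / P w - 1) \<le> r powr (1 / (2 * P w))"
      using r by (intro powr_mono') auto
    also have "\<dots> \<le> exp (- (gap P / 2)) powr (1 / (2 * P w))"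
      using r r_exp that by (intro powr_mono2) auto
    also have "\<dots> = exp (- (gap P / (4 * P w)))"
      by (simp add: powr_def)
    also have "\<dots> \<le> exp (- (1 / 4))"
      using that other(1)[OF that(2)] by (simp add: field_simps)
    also have "\<dots> \<le> 4 / 5" by (rule exp45)
    finally have "r * r powr (1 / P w - 1) \<le> r * (4 / 5)" using r by (intro mult_left_mono) auto
    then show ?thesis using that unfolding split[OF that(1)] by (intro mult_left_mono) (auto simp: mult.commute)
  qed
  \<comment> \<open>Every token is charged the factor \<open>4 / 5 * r\<close> and the mode is given
    back the missing \<open>r / 5\<close>, so that the full mass 1 can be summed.\<close>
  have "(\<Sum>w | 0 < P w. P w * r powr (1 / P w)) \<le> (\<Sum>w | 0 < P w. P w * (4 / 5 * r) + (if w = m then P m * (r / 5) else 0))"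
    using term_other term_m by (intro sum_mono) (auto simp: algebra_simps)
  also have "\<dots> = (\<Sum>w | 0 < P w. P w) * (4 / 5 * r) + P m * (r / 5)"
    using m(2) by (simp only: sum.distrib sum_distrib_right[symmetric]) simp
  also have "(\<Sum>w | 0 < P w. P w) * (4 / 5 * r) + P m * (r / 5) = r - gap P * r / 5"
    unfolding m(1) probvec_sum_support[OF P] by (simp add: field_simps)
  also have "\<dots> \<le> r - gap P / 10"
    using mult_left_mono[OF r(1) gap_bounds(1)[OF P]] by simp
  finally show ?thesis .
qed

section \<open>Chernoff bounds for the number of large observations\<close>

definition exceed :: "real \<Rightarrow> nat \<Rightarrow> (nat \<Rightarrow> real) \<Rightarrow> real"
  where "exceed r n y = (\<Sum>t<n. if r < y t then 1 else 0)"

lemma measurable_exceed [measurable]: "exceed r n \<in> borel_measurable (Yspace n)"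
proof -
  have f: "(\<lambda>u. if r < u then 1 else 0 :: real) \<in> borel_measurable borel" by measurable
  have m: "(\<lambda>y. if r < y t then 1 else 0 :: real) \<in> borel_measurable (Yspace n)" if "t < n" for t
  proof -
    have "(\<lambda>y. y t) \<in> borel_measurable (Yspace n)"
      unfolding Yspace_def using that by (intro measurable_component_singleton) simp
    from measurable_compose[OF this f] show ?thesis .
  qed
  show ?thesis
    unfolding exceed_def[abs_def]
    by (rule borel_measurable_sum[where f = "\<lambda>t y. if r < y t then 1 else 0"]) (rule m, simp)
qed

lemma measurable_exp_exceed:
  "(\<lambda>y. ennreal (exp (c * exceed r n y))) \<in> borel_measurable (Yspace n)"
  by measurable

lemma prod_exp_exceed:
  "(\<Prod>t<n. ennreal (exp (c * (if r < y t then 1 else 0)))) = ennreal (exp (c * exceed r n y))"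
  by (simp only: exceed_def sum_distrib_left exp_sum[OF finite_lessThan] prod_ennreal[OF exp_ge_zero])

text \<open>Chernoff's upper tail bound: Markov's inequality for
  \<open>exp (l * exceed r n y)\<close>, whose mean is a power by independence, with
  \<open>1 + x \<le> exp x\<close> for each factor.\<close>

lemma H0law_exceed_le:
  assumes r: "0 \<le> r" "r \<le> 1" and l: "0 \<le> l"
  shows "measure (H0law n) {y \<in> space (Yspace n). c < exceed r n y} \<le> exp (- l * c + real n * ((exp l - 1) * (1 - r)))"
proof -
  interpret H0: prob_space "H0law n" by (rule prob_space_H0law)
  interpret U: prob_space unif01 by (rule prob_space_unif01)
  let ?f = "\<lambda>u. ennreal (exp (l * (if r < u then 1 else 0)))"
  let ?A = "{y \<in> space (Yspace n). c < exceed r n y}"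
  have A: "?A \<in> sets (Yspace n)" by measurable
  have f: "?f \<in> borel_measurable borel" by measurable
  have e: "emeasure unif01 {r<..} = ennreal (1 - r)"
  proof -
    have "{0..1} \<inter> {r<..} = {r<..1}" using r by auto
    then show ?thesis using r unfolding unif01_def by (simp add: divide_ennreal_def)
  qed
  have "(\<integral>\<^sup>+u. ?f u \<partial>unif01) = (\<integral>\<^sup>+u. ennreal 1 + ennreal (exp l - 1) * indicator {r<..} u \<partial>unif01)"
  proof (rule nn_integral_cong)
    fix u
    show "?f u = ennreal 1 + ennreal (exp l - 1) * indicator {r<..} u"
      using l ennreal_plus[of 1 "exp l - 1"] by (cases "r < u") simp_all
  qed
  also have "\<dots> = ennreal 1 + ennreal (exp l - 1) * ennreal (1 - r)"
    by (simp add: nn_integral_add nn_integral_cmult U.emeasure_space_1[simplified] e cong: measurable_cong_sets)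
  also have "\<dots> = ennreal (1 + (exp l - 1) * (1 - r))"
    using l r by (simp add: ennreal_mult ennreal_plus del: ennreal_1)
  also have "\<dots> \<le> ennreal (exp ((exp l - 1) * (1 - r)))"
    by (intro ennreal_leI exp_ge_add_one_self)
  finally have int: "(\<integral>\<^sup>+u. ?f u \<partial>unif01) \<le> ennreal (exp ((exp l - 1) * (1 - r)))" .
  have "emeasure (H0law n) ?A = (\<integral>\<^sup>+y. indicator ?A y \<partial>H0law n)"
    using A by (simp add: sets_H0law)
  also have "\<dots> \<le> (\<integral>\<^sup>+y. ennreal (exp (- l * c)) * (\<Prod>t<n. ?f (y t)) \<partial>H0law n)"
    unfolding prod_exp_exceed
  proof (rule nn_integral_mono)
    fix y
    have "1 \<le> exp (- l * c) * exp (l * exceed r n y)" if "c < exceed r n y"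
      using mult_left_mono[OF less_imp_le[OF that] l] by (simp flip: exp_add)
    then show "indicator ?A y \<le> ennreal (exp (- l * c)) * ennreal (exp (l * exceed r n y))"
      by (auto simp: indicator_def simp flip: ennreal_mult ennreal_1)
  qed
  also have "\<dots> = ennreal (exp (- l * c)) * (\<integral>\<^sup>+y. (\<Prod>t<n. ?f (y t)) \<partial>H0law n)"
    unfolding prod_exp_exceed
    by (rule nn_integral_cmult) (use measurable_exp_exceed measurable_cong_sets[OF sets_H0law refl] in blast)
  also have "\<dots> \<le> ennreal (exp (- l * c)) * ennreal (exp ((exp l - 1) * (1 - r))) ^ n"
    unfolding nn_integral_H0law_prod[OF f] by (intro mult_left_mono power_mono int) auto
  also have "\<dots> = ennreal (exp (- l * c + real n * ((exp l - 1) * (1 - r))))"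
    by (simp only: ennreal_power[OF exp_ge_zero] exp_of_nat_mult[symmetric] ennreal_mult[symmetric] exp_ge_zero exp_add)
  finally show ?thesis by (simp add: H0.emeasure_eq_measure)
qed

context gumbel_model
begin

text \<open>Chernoff's lower tail bound, with \<open>product_bound\<close> in place of independence.
  Given any past, an observation exceeds \<open>1 - D / 2\<close> with probability at least
  \<open>D / 2 + eps * D / 10\<close> by \<open>gumbel_cdf_le\<close>.\<close>

lemma H1law_exceed_le:
  assumes D: "0 \<le> D" "D \<le> 1" and l: "0 \<le> l"
  shows "measure (H1law eps K N) {y \<in> space (Yspace N). exceed (1 - D / 2) N y \<le> c}
    \<le> exp (l * c - real N * ((1 - exp (- l)) * (D / 2 + eps * D / 10)))"
proof -
  interpret H1: prob_space "H1law eps K N" by (rule prob_space_H1law) simp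
  let ?r = "1 - D / 2"
  let ?f = "\<lambda>u. ennreal (exp (- l * (if ?r < u then 1 else 0)))"
  let ?A = "{y \<in> space (Yspace N). exceed ?r N y \<le> c}"
  let ?b = "ennreal (exp (- ((1 - exp (- l)) * (D / 2 + eps * D / 10))))"
  have A: "?A \<in> sets (Yspace N)" by measurable
  have f: "?f \<in> borel_measurable borel" by measurable
  have int: "(\<integral>\<^sup>+u. ?f u * ennreal (mix_dens eps P u) \<partial>unif01) \<le> ?b"
    if P: "probvec P" "gap P = D" for P :: "'w \<Rightarrow> real"
  proof -
    have cdf: "(1 - eps) * ?r + eps * (\<Sum>w | 0 < P w. P w * ?r powr (1 / P w)) \<le> ?r - eps * D / 10"
    proof -
      have "eps * (\<Sum>w | 0 < P w. P w * ?r powr (1 / P w)) \<le> eps * (?r - D / 10)"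
        using mult_left_mono[OF gumbel_cdf_le[OF P(1)] eps(1)] unfolding P(2) .
      moreover have "(1 - eps) * ?r + eps * (?r - D / 10) = ?r - eps * D / 10"
        by (simp add: field_simps)
      ultimately show ?thesis by linarith
    qed
    have pos: "0 \<le> ?r - eps * D / 10"
      using mult_mono[OF eps(2) D(2)] eps D by simp
    \<comment> \<open>The function is rewritten with a nonnegative coefficient in front of the
      indicator of \<open>{..?r}\<close>, so that the upper bound \<open>cdf\<close> points in the
      right direction.\<close>
    have "(\<integral>\<^sup>+u. ?f u * ennreal (mix_dens eps P u) \<partial>unif01) =
      (\<integral>\<^sup>+u. ennreal (exp (- l)) * ennreal (mix_dens eps P u) +
        ennreal (1 - exp (- l)) * (indicator {..?r} u * ennreal (mix_dens eps P u)) \<partial>unif01)"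
    proof (rule nn_integral_cong)
      fix u
      have "?f u = ennreal (exp (- l)) + ennreal (1 - exp (- l)) * indicator {..?r} u"
        using l by (auto simp: indicator_def simp flip: ennreal_plus)
      then show "?f u * ennreal (mix_dens eps P u) = ennreal (exp (- l)) * ennreal (mix_dens eps P u) +
        ennreal (1 - exp (- l)) * (indicator {..?r} u * ennreal (mix_dens eps P u))"
        by (simp add: distrib_right mult.assoc)
    qed
    also have "\<dots> = ennreal (exp (- l)) * (\<integral>\<^sup>+u. ennreal (mix_dens eps P u) \<partial>unif01) +
       ennreal (1 - exp (- l)) * (\<integral>\<^sup>+u. indicator {..?r} u * ennreal (mix_dens eps P u) \<partial>unif01)"
      by (simp add: nn_integral_add nn_integral_cmult cong: measurable_cong_sets)
    also have "\<dots> \<le> ennreal (exp (- l)) * 1 + ennreal (1 - exp (- l)) * ennreal (?r - eps * D / 10)"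
      using D by (subst nn_integral_mix_dens_atMost[OF P(1) eps])
        (auto simp: nn_integral_mix_dens[OF P(1) eps] intro!: mult_left_mono ennreal_leI cdf)
    also have "\<dots> = ennreal (exp (- l) + (1 - exp (- l)) * (?r - eps * D / 10))"
      using l pos by (simp add: ennreal_mult ennreal_plus)
    also have "\<dots> \<le> ?b"
      using exp_ge_add_one_self[of "- ((1 - exp (- l)) * (D / 2 + eps * D / 10))"]
      by (intro ennreal_leI) (simp add: algebra_simps)
    finally show ?thesis .
  qed
  have "emeasure (H1law eps K N) ?A = (\<integral>\<^sup>+y. indicator ?A y \<partial>H1law eps K N)"
    using A by (simp add: sets_H1law)
  also have "\<dots> \<le> (\<integral>\<^sup>+y. ennreal (exp (l * c)) * (\<Prod>t<N. ?f (y t)) \<partial>H1law eps K N)"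
    unfolding prod_exp_exceed
  proof (rule nn_integral_mono)
    fix y
    have "1 \<le> exp (l * c) * exp (- l * exceed ?r N y)" if "exceed ?r N y \<le> c"
      using mult_left_mono[OF that l] by (simp flip: exp_add)
    then show "indicator ?A y \<le> ennreal (exp (l * c)) * ennreal (exp (- l * exceed ?r N y))"
      by (auto simp: indicator_def simp flip: ennreal_mult ennreal_1)
  qed
  also have "\<dots> = ennreal (exp (l * c)) * (\<integral>\<^sup>+y. (\<Prod>t<N. ?f (y t)) \<partial>H1law eps K N)"
    unfolding prod_exp_exceed
    by (rule nn_integral_cmult) (use measurable_exp_exceed measurable_cong_sets[OF sets_H1law refl] in blast)
  also have "\<dots> \<le> ennreal (exp (l * c)) * ?b ^ N"
    by (intro mult_left_mono product_bound[OF f int]) auto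
  also have "\<dots> = ennreal (exp (l * c + real N * (- ((1 - exp (- l)) * (D / 2 + eps * D / 10)))))"
    by (simp only: ennreal_power[OF exp_ge_zero] exp_of_nat_mult[symmetric] ennreal_mult[symmetric] exp_ge_zero exp_add)
  finally show ?thesis by (simp add: H1.emeasure_eq_measure)
qed

lemma exists_good_test:
  assumes D: "0 \<le> D" "D \<le> 1"
  obtains A where "A \<in> sets (Yspace N)"
    "measure (H0law N) A + measure (H1law eps K N) (space (Yspace N) - A) \<le> 2 * exp (- (real N * D * eps\<^sup>2 / 1000))"
proof -
  \<comment> \<open>The gain \<open>eps * D / 10\<close> of the alternative equals
    \<open>2 * l * D\<close>, so the threshold \<open>c\<close> lies halfway between the null mean
    and the lower bound for the alternative mean. The same \<open>l\<close> serves as the Chernoff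
    parameter on both sides.\<close>
  define l where "l = eps / 20"
  define c where "c = real N * (D / 2 + l * D)"
  let ?A = "{y \<in> space (Yspace N). c < exceed (1 - D / 2) N y}"
  have l: "0 \<le> l" "l \<le> 1 / 20" using eps by (auto simp: l_def)
  have ND: "0 \<le> real N * D" using D by simp
  have up: "exp l - 1 \<le> l + l\<^sup>2" using exp_bound[of l] l by simp
  have lo: "l - l\<^sup>2 \<le> 1 - exp (- l)"
  proof -
    have "exp (- l) \<le> 1 / (1 + l)"
      using exp_ge_add_one_self[of l] l by (simp add: exp_minus field_simps)
    also have "\<dots> \<le> 1 - l + l\<^sup>2"
      using l by (simp add: field_simps power2_eq_square)
    finally show ?thesis by simp
  qed
  have l2: "l\<^sup>2 = eps\<^sup>2 / 400" by (simp add: l_def power_divide)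
  have ep: "eps = 20 * l" by (simp add: l_def)
  have "- l * c + real N * ((exp l - 1) * (1 - (1 - D / 2))) \<le> - l * c + real N * ((l + l\<^sup>2) * (D / 2))"
    using up D by (intro add_left_mono mult_left_mono) (auto intro: mult_right_mono)
  also have "\<dots> = - (real N * D * (l\<^sup>2 / 2))"
    by (simp add: c_def field_simps power2_eq_square)
  also have "\<dots> \<le> - (real N * D * (eps\<^sup>2 / 1000))"
    unfolding l2 by (intro le_imp_neg_le mult_left_mono ND) simp
  finally have e0: "- l * c + real N * ((exp l - 1) * (1 - (1 - D / 2))) \<le> - (real N * D * eps\<^sup>2 / 1000)"
    by simp
  have "l * c - real N * ((1 - exp (- l)) * (D / 2 + eps * D / 10)) \<le> l * c - real N * ((l - l\<^sup>2) * (D / 2 + eps * D / 10))"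
    using lo D eps by (intro diff_left_mono mult_left_mono mult_right_mono) auto
  also have "\<dots> = real N * D * (l\<^sup>2 * (2 * l - 1 / 2))"
    unfolding ep by (simp add: c_def field_simps power2_eq_square)
  \<comment> \<open>As \<open>l \<le> 1 / 20\<close>, the cubic correction \<open>2 * l\<close> uses
    up at most 1/10 of the 1/2. The remaining \<open>2 / 5 * l\<^sup>2\<close> is exactly
    \<open>eps\<^sup>2 / 1000\<close>; the null side has the better constant 1/800.\<close>
  also have "\<dots> \<le> real N * D * (l\<^sup>2 * (- (2 / 5)))"
    using ND l by (intro mult_left_mono) auto
  also have "\<dots> = - (real N * D * eps\<^sup>2 / 1000)"
    by (simp add: l2)
  finally have e1: "l * c - real N * ((1 - exp (- l)) * (D / 2 + eps * D / 10)) \<le> - (real N * D * eps\<^sup>2 / 1000)" .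
  have compl: "space (Yspace N) - ?A = {y \<in> space (Yspace N). exceed (1 - D / 2) N y \<le> c}" by auto
  have "measure (H0law N) ?A \<le> exp (- (real N * D * eps\<^sup>2 / 1000))"
    using H0law_exceed_le[of "1 - D / 2" l N c] D l e0 by (simp del: mult_minus_left) (meson exp_le_cancel_iff order_trans)
  moreover have "measure (H1law eps K N) (space (Yspace N) - ?A) \<le> exp (- (real N * D * eps\<^sup>2 / 1000))"
    unfolding compl using H1law_exceed_le[OF D l(1), of c] e1 by (meson exp_le_cancel_iff order_trans)
  ultimately show thesis
    by (intro that[of ?A]) (auto, measurable)
qed

end

section \<open>The two regimes of the rate\<close>

theorem theorem4p2:
  fixes eps Delta :: "nat \<Rightarrow> real" and p q :: real
    and K :: "nat \<Rightarrow> nat \<Rightarrow> (nat \<Rightarrow> ('w::{finite,linorder}) state) \<Rightarrow> ('w \<Rightarrow> real) measure"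
  assumes p: "0 \<le> p" "p \<le> 1/2" and q: "0 \<le> q" "q \<le> 1"
    and eps_prob: "\<And>n. 0 \<le> eps n \<and> eps n \<le> 1"
    and eps_rate: "asymp_equiv (\<lambda>n. real n powr (-p)) eps"
    and Delta_rate: "asymp_equiv (\<lambda>n. real n powr (-q)) Delta"
    and K_meas: "\<And>n t. K n t \<in> measurable histM (prob_algebra vecM)"
    and K_B: "\<And>n t h. t < n \<Longrightarrow> h \<in> space histM \<Longrightarrow>
                 (AE P in K n t h. probvec P \<and> gap P = Delta n)"
  shows "(q + 2*p > 1 \<longrightarrow>
            (\<lambda>n. tvdist (H0law n) (H1law (eps n) (K n) n)) \<longlonglongrightarrow> 0 \<and>
            (\<forall>R. (\<forall>n. R n \<in> sets (Yspace n)) \<longrightarrow>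
               (\<lambda>n. measure (H0law n) (R n)
                    + measure (H1law (eps n) (K n) n) (space (Yspace n) - R n)) \<longlonglongrightarrow> 1))
       \<and> (q + 2*p < 1 \<longrightarrow>
            \<not> ((\<lambda>n. tvdist (H0law n) (H1law (eps n) (K n) n)) \<longlonglongrightarrow> 0) \<and>
            (\<lambda>n. measure (H0law n) (LR_reject (eps n) (K n) n)
                 + measure (H1law (eps n) (K n) n) (space (Yspace n) - LR_reject (eps n) (K n) n))
              \<longlonglongrightarrow> 0)"
proof -
  \<comment> \<open>Each sample size is its own instance of the locale, with its own mixing weight,
    gap and kernels.\<close>
  have M: "gumbel_model (eps n) (Delta n) (K n) n" for n
    using eps_prob K_meas K_B by unfold_locales auto
  obtain e1 e2 where e: "0 < e1" "0 < e2"
    "\<And>n. 1 \<le> n \<Longrightarrow> e1 * real n powr (-p) \<le> eps n" "\<And>n. 1 \<le> n \<Longrightarrow> eps n \<le> e2 * real n powr (-p)"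
    using eps_rate unfolding asymp_equiv_def by auto
  obtain d1 d2 where d: "0 < d1" "0 < d2"
    "\<And>n. 1 \<le> n \<Longrightarrow> d1 * real n powr (-q) \<le> Delta n" "\<And>n. 1 \<le> n \<Longrightarrow> Delta n \<le> d2 * real n powr (-q)"
    using Delta_rate unfolding asymp_equiv_def by auto
  let ?P0 = "\<lambda>n. H0law n" and ?P1 = "\<lambda>n. H1law (eps n) (K n) n"
  have prob0: "prob_space (?P0 n)" for n by (rule prob_space_H0law)
  have prob1: "prob_space (?P1 n)" for n by (rule gumbel_model.prob_space_H1law[OF M order_refl])
  have sets: "sets (?P0 n) = sets (Yspace n)" "sets (?P1 n) = sets (Yspace n)" for n
    by (rule sets_H0law, rule gumbel_model.sets_H1law[OF M])
  have compl: "measure (?P1 n) (space (Yspace n) - A) = 1 - measure (?P1 n) A" if "A \<in> sets (Yspace n)" for n A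
    using prob_space.prob_compl[OF prob1, of A n] that sets(2)[of n] sets_eq_imp_space_eq[OF sets(2), of n] by simp
  have tv_ge: "\<bar>measure (?P0 n) A - measure (?P1 n) A\<bar> \<le> tvdist (?P0 n) (?P1 n)" if "A \<in> sets (Yspace n)" for n A
    by (rule tvdist_ge[OF prob0 prob1]) (use that sets in simp_all)
  have tv_nonneg: "0 \<le> tvdist (?P0 n) (?P1 n)" for n
    using tv_ge[of "{}" n] by simp
  \<comment> \<open>The order of \<open>n * (eps n)\<^sup>2 * Delta n\<close>, the quantity in both
    the merging and the separating bound; the sign of its exponent tells the regimes apart.\<close>
  have rate: "real n * (real n powr (-p))\<^sup>2 * real n powr (-q) = real n powr (1 - q - 2 * p)" if "1 \<le> n" for n
  proof -
    have "real n * (real n powr (-p))\<^sup>2 * real n powr (-q) = real n powr 1 * real n powr (-p) * real n powr (-p) * real n powr (-q)"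
      using that by (simp add: power2_eq_square)
    also have "\<dots> = real n powr (1 - q - 2 * p)"
      by (simp only: powr_add[symmetric]) (simp add: algebra_simps)
    finally show ?thesis .
  qed
  show ?thesis
  proof (intro conjI impI)
    assume sub: "1 < q + 2 * p"
    define C where "C = e2\<^sup>2 * (real CARD('w))\<^sup>2 * d2"
    \<comment> \<open>Chosen so that \<open>1 + (s n)\<^sup>2\<close> is the exponential bound for
      \<open>(1 + (eps n)\<^sup>2 * (real CARD('w))\<^sup>2 * Delta n) ^ n\<close> that comes from
      \<open>1 + x \<le> exp x\<close> and the upper rate constants.\<close>
    define s where "s n = sqrt (exp (C * real n powr (1 - q - 2 * p)) - 1)" for n
    have C: "0 < C" using e d by (simp add: C_def)
    have "(\<lambda>n. real n powr (1 - q - 2 * p)) \<longlonglongrightarrow> 0"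
      using sub by (intro tendsto_neg_powr filterlim_real_sequentially) auto
    then have "(\<lambda>n. sqrt (exp (C * real n powr (1 - q - 2 * p)) - 1)) \<longlonglongrightarrow> sqrt (exp (C * 0) - 1)"
      by (intro tendsto_intros)
    then have "s \<longlonglongrightarrow> 0" by (simp add: s_def[abs_def])
    then have "(\<lambda>n. s n + (s n)\<^sup>2 + s n ^ 3 / 2) \<longlonglongrightarrow> 0 + 0\<^sup>2 + 0 ^ 3 / 2"
      by (intro tendsto_intros) auto
    then have s_lim: "(\<lambda>n. s n + (s n)\<^sup>2 + s n ^ 3 / 2) \<longlonglongrightarrow> 0" by simp
    have tv_le: "tvdist (?P0 n) (?P1 n) \<le> s n + (s n)\<^sup>2 + s n ^ 3 / 2" if n: "1 \<le> n" for n
    proof (rule tvdist_le)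
      fix A assume "A \<in> sets (?P0 n)"
      then have A: "A \<in> sets (Yspace n)" by (simp add: sets)
      have D: "0 \<le> Delta n" using gumbel_model.D_bounds[OF M, of n] n by simp
      \<comment> \<open>Makes \<open>s n\<close> strictly positive, as
        \<open>abs_measure_diff_le\<close> divides by it.\<close>
      have x: "0 < exp (C * real n powr (1 - q - 2 * p)) - 1"
        using C n by simp
      have s2: "(s n)\<^sup>2 = exp (C * real n powr (1 - q - 2 * p)) - 1"
        using x by (simp add: s_def)
      have "(1 + (eps n)\<^sup>2 * (real CARD('w))\<^sup>2 * Delta n) ^ n \<le> exp ((eps n)\<^sup>2 * (real CARD('w))\<^sup>2 * Delta n) ^ n"
        using D by (intro power_mono exp_ge_add_one_self) simp
      also have "\<dots> = exp (real n * (eps n)\<^sup>2 * (real CARD('w))\<^sup>2 * Delta n)"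
        by (simp add: exp_of_nat_mult mult.assoc flip: exp_of_nat_mult)
      also have "real n * (eps n)\<^sup>2 * (real CARD('w))\<^sup>2 * Delta n
        \<le> real n * (e2 * real n powr (-p))\<^sup>2 * (real CARD('w))\<^sup>2 * (d2 * real n powr (-q))"
        using e(4)[OF n] d(4)[OF n] eps_prob[of n] D
        by (intro mult_mono mult_nonneg_nonneg power_mono) auto
      also have "\<dots> = C * (real n * (real n powr (-p))\<^sup>2 * real n powr (-q))"
        by (simp add: C_def power_mult_distrib mult_ac)
      also have "\<dots> = C * real n powr (1 - q - 2 * p)"
        by (simp only: rate[OF n])
      finally have "(1 + (eps n)\<^sup>2 * (real CARD('w))\<^sup>2 * Delta n) ^ n \<le> 1 + (s n)\<^sup>2"
        by (simp add: s2)
      then show "\<bar>measure (?P0 n) A - measure (?P1 n) A\<bar> \<le> s n + (s n)\<^sup>2 + s n ^ 3 / 2"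
        using x by (intro gumbel_model.abs_measure_diff_le[OF M A _ _ D]) (simp add: s_def)
    qed
    show tv0: "(\<lambda>n. tvdist (?P0 n) (?P1 n)) \<longlonglongrightarrow> 0"
      by (rule tendsto_sandwich[OF _ _ tendsto_const s_lim])
        (use tv_nonneg tv_le in \<open>auto intro: eventually_sequentiallyI\<close>)
    show "\<forall>R. (\<forall>n. R n \<in> sets (Yspace n)) \<longrightarrow>
      (\<lambda>n. measure (?P0 n) (R n) + measure (?P1 n) (space (Yspace n) - R n)) \<longlonglongrightarrow> 1"
    proof (intro allI impI)
      fix R assume R: "\<forall>n. R n \<in> sets (Yspace n)"
      \<comment> \<open>The sum of the two errors is 1 plus this difference, whose absolute value is
        at most the total variation distance.\<close>
      have "(\<lambda>n. measure (?P0 n) (R n) - measure (?P1 n) (R n)) \<longlonglongrightarrow> 0"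
        by (rule Lim_null_comparison[OF _ tv0]) (use tv_ge R in auto)
      then have "(\<lambda>n. 1 + (measure (?P0 n) (R n) - measure (?P1 n) (R n))) \<longlonglongrightarrow> 1 + 0"
        by (intro tendsto_intros)
      then show "(\<lambda>n. measure (?P0 n) (R n) + measure (?P1 n) (space (Yspace n) - R n)) \<longlonglongrightarrow> 1"
        using R by (simp add: compl algebra_simps)
    qed
  next
    assume super: "q + 2 * p < 1"
    let ?R = "\<lambda>n. LR_reject (eps n) (K n) n"
    let ?err = "\<lambda>n. measure (?P0 n) (?R n) + measure (?P1 n) (space (Yspace n) - ?R n)"
    \<comment> \<open>The lower rate constants put into the exponent of
      \<open>exists_good_test\<close>.\<close>
    define C where "C = e1\<^sup>2 * d1 / 1000"
    have C: "0 < C" using e d by (simp add: C_def)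
    have err_le: "?err n \<le> 2 * exp (- (C * real n powr (1 - q - 2 * p)))" if n: "1 \<le> n" for n
    proof -
      have D: "0 \<le> Delta n" "Delta n \<le> 1" using gumbel_model.D_bounds[OF M, of n] n by simp_all
      obtain A where A: "A \<in> sets (Yspace n)"
        "measure (?P0 n) A + measure (?P1 n) (space (Yspace n) - A) \<le> 2 * exp (- (real n * Delta n * (eps n)\<^sup>2 / 1000))"
        using gumbel_model.exists_good_test[OF M D] by blast
      have "C * real n powr (1 - q - 2 * p) = C * (real n * (real n powr (-p))\<^sup>2 * real n powr (-q))"
        by (simp only: rate[OF n])
      also have "\<dots> = real n * (d1 * real n powr (-q)) * (e1 * real n powr (-p))\<^sup>2 / 1000"
        by (simp add: C_def power_mult_distrib mult_ac)
      also have "\<dots> \<le> real n * Delta n * (eps n)\<^sup>2 / 1000"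
        using e(1) e(3)[OF n] d(1) d(3)[OF n] D(1)
        by (intro divide_right_mono mult_mono power_mono mult_nonneg_nonneg) auto
      finally have "exp (- (real n * Delta n * (eps n)\<^sup>2 / 1000)) \<le> exp (- (C * real n powr (1 - q - 2 * p)))"
        by simp
      then show ?thesis
        using gumbel_model.LR_test_optimal[OF M A(1)] A(2) by linarith
    qed
    have "filterlim (\<lambda>n. real n powr (1 - q - 2 * p)) at_top sequentially"
      using super by (intro filterlim_compose[OF real_powr_at_top filterlim_real_sequentially]) auto
    then have "filterlim (\<lambda>n. C * real n powr (1 - q - 2 * p)) at_top sequentially"
      by (intro filterlim_tendsto_pos_mult_at_top[OF tendsto_const C])
    then have "filterlim (\<lambda>n. - (C * real n powr (1 - q - 2 * p))) at_bot sequentially"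
      by (simp add: filterlim_uminus_at_top)
    then have "(\<lambda>n. exp (- (C * real n powr (1 - q - 2 * p)))) \<longlonglongrightarrow> 0"
      by (rule filterlim_compose[OF exp_at_bot])
    from tendsto_mult_right_zero[OF this, of 2]
    have lim: "(\<lambda>n. 2 * exp (- (C * real n powr (1 - q - 2 * p)))) \<longlonglongrightarrow> 0" by simp
    show err0: "?err \<longlonglongrightarrow> 0"
      by (rule tendsto_sandwich[OF _ _ tendsto_const lim])
        (use err_le in \<open>auto intro: eventually_sequentiallyI\<close>)
    show "\<not> (\<lambda>n. tvdist (?P0 n) (?P1 n)) \<longlonglongrightarrow> 0"
    proof
      assume tv0: "(\<lambda>n. tvdist (?P0 n) (?P1 n)) \<longlonglongrightarrow> 0"
      have R: "?R n \<in> sets (Yspace n)" for n by (rule gumbel_model.sets_LR_reject[OF M])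
      \<comment> \<open>The error sum of the test \<open>?R n\<close> is
        \<open>1 + measure (?P0 n) (?R n) - measure (?P1 n) (?R n)\<close>, hence at least 1 minus
        the distance; error sum and distance cannot both tend to 0.\<close>
      have "1 \<le> ?err n + tvdist (?P0 n) (?P1 n)" for n
        using tv_ge[OF R, of n] compl[OF R, of n] by linarith
      moreover have "(\<lambda>n. ?err n + tvdist (?P0 n) (?P1 n)) \<longlonglongrightarrow> 0 + 0"
        by (intro tendsto_add err0 tv0)
      ultimately have "1 \<le> (0 + 0 :: real)"
        by (intro tendsto_lowerbound[OF _ _ trivial_limit_sequentially]) auto
      then show False by simp
    qed
  qed
qed


end
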